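(* The Lie group $G=\mathrm{SU}(2)\times\mathrm{U}(1)^4$ admits left-invariant strong $\mathrm{G}_2T$-structures solving the twisted $\mathrm{G}_2$ equation $$d\varphi\wedge\varphi=0,\qquad d\star\varphi=\theta\wedge\star\varphi,\qquad dT=0,\qquad d\theta=0.$$
   Context: The structures in question are non-parallel, i.e. $T\neq0$. Write $e^{ij\cdots}=e^i\wedge e^j\wedge\cdots$. A $\mathrm{G}_2$-structure on a $7$-manifold $M$ is a definite $3$-form $\varphi$: at each point there is a coframe $(e^1,\dots,e^7)$ with $\varphi=e^{123}+e^1\wedge(e^{45}+e^{67})+e^2\wedge(e^{46}-e^{57})-e^3\wedge(e^{47}+e^{56})$. It induces the metric $g_\varphi$ for which this coframe is orthonormal, the orientation $e^{1234567}$, and a Hodge operator $\star$. It is a $\mathrm{G}_2T$-structure if $d\star\varphi=\theta\wedge\star\varphi$ for some $1$-form $\theta$ (the Lee form; necessarily $\theta=-\frac13\star(\star d\varphi\wedge\varphi)$). Its torsion $3$-form is $T=\frac16\star(d\varphi\wedge\varphi)\,\varphi-\star d\varphi+\star(\theta\wedge\varphi)$. A $\mathrm{G}_2T$-structure is strong if $dT=0$. *)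

theory Defs
  imports "HOL-Analysis.Analysis"
begin

section \<open>Differential forms on an embedded submanifold\<close>

text \<open>
  A \<open>k\<close>-covector takes its arguments as a tuple \<open>v 0, \<dots>, v (k - 1)\<close>; the entries of
  \<open>v :: nat \<Rightarrow> 'a\<close> from index \<open>k\<close> on are ignored.  A differential form on a submanifold \<open>M\<close>
  of a normed space is a field of covectors of which only the values at points of \<open>M\<close> and on
  vectors tangent to \<open>M\<close> matter.
\<close>

type_synonym 'a covector = "(nat \<Rightarrow> 'a) \<Rightarrow> real"
type_synonym 'a form = "'a \<Rightarrow> 'a covector"

definition tangent_space :: "'a::real_normed_vector set \<Rightarrow> 'a \<Rightarrow> 'a set" where
  "tangent_space M p =
     {v. \<exists>\<gamma> :: real \<Rightarrow> 'a. range \<gamma> \<subseteq> M \<and> \<gamma> 0 = p \<and> (\<gamma> has_vector_derivative v) (at 0)}"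

definition alternating_form :: "'a::real_vector set \<Rightarrow> nat \<Rightarrow> 'a covector \<Rightarrow> bool" where
  "alternating_form V k \<omega> \<longleftrightarrow>
     (\<forall>v w. (\<forall>i<k. v i \<in> V \<and> w i = v i) \<longrightarrow> \<omega> w = \<omega> v) \<and>
     (\<forall>v. \<forall>i<k. \<forall>x\<in>V. \<forall>y\<in>V. \<forall>a b. (\<forall>j<k. v j \<in> V) \<longrightarrow>
        \<omega> (v(i := a *\<^sub>R x + b *\<^sub>R y)) = a * \<omega> (v(i := x)) + b * \<omega> (v(i := y))) \<and>
     (\<forall>v. \<forall>i<k. \<forall>j<k. (\<forall>l<k. v l \<in> V) \<and> i \<noteq> j \<and> v i = v j \<longrightarrow> \<omega> v = 0)"

definition differential_form :: "'a::real_normed_vector set \<Rightarrow> nat \<Rightarrow> 'a form \<Rightarrow> bool" where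
  "differential_form M k \<alpha> \<longleftrightarrow> (\<forall>p\<in>M. alternating_form (tangent_space M p) k (\<alpha> p))"

definition form_eq :: "'a::real_normed_vector set \<Rightarrow> nat \<Rightarrow> 'a form \<Rightarrow> 'a form \<Rightarrow> bool" where
  "form_eq M k \<alpha> \<beta> \<longleftrightarrow>
     (\<forall>p\<in>M. \<forall>v. (\<forall>i<k. v i \<in> tangent_space M p) \<longrightarrow> \<alpha> p v = \<beta> p v)"

definition zero_form :: "'a form" where
  "zero_form = (\<lambda>p v. 0)"

definition omit :: "nat \<Rightarrow> (nat \<Rightarrow> 'a) \<Rightarrow> nat \<Rightarrow> 'a" where
  "omit i v = (\<lambda>j. if j < i then v j else v (Suc j))"

text \<open>
  The exterior derivative on \<open>M\<close>: extend \<open>\<alpha>\<close> near \<open>p\<close> to a differentiable form \<open>\<alpha>'\<close> on an open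
  subset of the ambient space, apply the flat formula
  \<open>d\<alpha>'(v\<^sub>0, \<dots>, v\<^sub>k) = \<Sum>\<^sub>i (-1)\<^sup>i (D\<^bsub>v\<^sub>i\<^esub> \<alpha>')(v\<^sub>0, \<dots>, v\<^sub>i omitted, \<dots>, v\<^sub>k)\<close>
  and restrict to tangent vectors of \<open>M\<close>.  Since \<open>d\<close> commutes with pullback along the inclusion,
  the result does not depend on the extension.
\<close>

definition has_exterior_derivative ::
    "'a::real_normed_vector set \<Rightarrow> nat \<Rightarrow> 'a form \<Rightarrow> 'a form \<Rightarrow> bool" where
  "has_exterior_derivative M k \<alpha> \<beta> \<longleftrightarrow>
     (\<forall>p\<in>M. \<exists>U \<alpha>'. open U \<and> p \<in> U \<and>
        (\<forall>q\<in>U. alternating_form UNIV k (\<alpha>' q)) \<and>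
        (\<forall>q\<in>U. \<forall>v. (\<lambda>x. \<alpha>' x v) differentiable (at q)) \<and>
        (\<forall>q\<in>M \<inter> U. \<forall>v. (\<forall>i<k. v i \<in> tangent_space M q) \<longrightarrow> \<alpha>' q v = \<alpha> q v) \<and>
        (\<forall>v. (\<forall>i\<le>k. v i \<in> tangent_space M p) \<longrightarrow>
           \<beta> p v = (\<Sum>i\<le>k. (-1) ^ i * frechet_derivative (\<lambda>x. \<alpha>' x (omit i v)) (at p) (v i))))"

definition pullback :: "('a::real_normed_vector \<Rightarrow> 'a) \<Rightarrow> 'a form \<Rightarrow> 'a form" where
  "pullback f \<alpha> = (\<lambda>p v. \<alpha> (f p) (\<lambda>i. frechet_derivative f (at p) (v i)))"

text \<open>
  Wedge product of a \<open>k\<close>- and an \<open>l\<close>-covector, normalised so that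
  \<open>(\<alpha> \<and> \<beta>)(u, v) = \<alpha>(u) \<beta>(v) - \<alpha>(v) \<beta>(u)\<close> for 1-covectors.
\<close>

definition wedge :: "nat \<Rightarrow> nat \<Rightarrow> 'a covector \<Rightarrow> 'a covector \<Rightarrow> 'a covector" where
  "wedge k l \<alpha> \<beta> = (\<lambda>v. (\<Sum>\<sigma> | \<sigma> permutes {..<k + l}.
      of_int (sign \<sigma>) * \<alpha> (\<lambda>i. v (\<sigma> i)) * \<beta> (\<lambda>i. v (\<sigma> (k + i)))) / (fact k * fact l))"


section \<open>$\mathrm{G}_2$-structures\<close>

text \<open>
  A coframe \<open>e 1, \<dots>, e 7\<close> of \<open>V\<close> is a linear isomorphism of \<open>V\<close> with \<open>\<real>\<^sup>7\<close>.
\<close>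

definition coframe7 :: "'a::real_vector set \<Rightarrow> (nat \<Rightarrow> 'a \<Rightarrow> real) \<Rightarrow> bool" where
  "coframe7 V e \<longleftrightarrow> subspace V \<and>
     (\<forall>i\<in>{1..7}. \<forall>x\<in>V. \<forall>y\<in>V. \<forall>a b. e i (a *\<^sub>R x + b *\<^sub>R y) = a * e i x + b * e i y) \<and>
     (\<forall>c :: nat \<Rightarrow> real. \<exists>!x. x \<in> V \<and> (\<forall>i\<in>{1..7}. e i x = c i))"

definition dual_frame :: "'a set \<Rightarrow> (nat \<Rightarrow> 'a \<Rightarrow> real) \<Rightarrow> nat \<Rightarrow> 'a" where
  "dual_frame V e i = (THE x. x \<in> V \<and> (\<forall>j\<in>{1..7}. e j x = (if j = i then 1 else 0)))"

text \<open>\<open>coframe_wedge e [i\<^sub>1, \<dots>, i\<^sub>k]\<close> is \<open>e i\<^sub>1 \<and> \<dots> \<and> e i\<^sub>k\<close>.\<close>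

definition coframe_wedge :: "(nat \<Rightarrow> 'a \<Rightarrow> real) \<Rightarrow> nat list \<Rightarrow> 'a covector" where
  "coframe_wedge e is = (\<lambda>v. \<Sum>\<sigma> | \<sigma> permutes {..<length is}.
      of_int (sign \<sigma>) * (\<Prod>j<length is. e (is ! j) (v (\<sigma> j))))"

definition g2_model :: "(nat \<Rightarrow> 'a \<Rightarrow> real) \<Rightarrow> 'a covector" where
  "g2_model e = (\<lambda>v. coframe_wedge e [1,2,3] v
     + (coframe_wedge e [1,4,5] v + coframe_wedge e [1,6,7] v)
     + (coframe_wedge e [2,4,6] v - coframe_wedge e [2,5,7] v)
     - (coframe_wedge e [3,4,7] v + coframe_wedge e [3,5,6] v))"

text \<open>
  \<open>\<phi>\<close> is a definite 3-form on \<open>M\<close> and \<open>e\<close> selects at every point a coframe in which \<open>\<phi>\<close> has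
  the standard form.  No continuity of \<open>e\<close> is required: any two such coframes at a point differ
  by an element of $\mathrm{G}_2 \subset \mathrm{SO}(7)$, so metric, orientation and Hodge
  operator depend on \<open>\<phi>\<close> only.
\<close>

definition G2_structure ::
    "'a::real_normed_vector set \<Rightarrow> 'a form \<Rightarrow> ('a \<Rightarrow> nat \<Rightarrow> 'a \<Rightarrow> real) \<Rightarrow> bool" where
  "G2_structure M \<phi> e \<longleftrightarrow> differential_form M 3 \<phi> \<and>
     (\<forall>p\<in>M. coframe7 (tangent_space M p) (e p)) \<and>
     form_eq M 3 \<phi> (\<lambda>p. g2_model (e p))"

text \<open>
  Hodge operator on \<open>k\<close>-forms for the metric in which the coframe is orthonormal and the
  orientation \<open>e 1 \<and> \<dots> \<and> e 7\<close>: the linear map with \<open>\<star>e\<^sup>I = \<epsilon> e\<^sup>J\<close>, where \<open>J\<close> is the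
  complement of \<open>I\<close> and the sign \<open>\<epsilon>\<close> satisfies \<open>e\<^sup>I \<and> e\<^sup>J = \<epsilon> e 1 \<and> \<dots> \<and> e 7\<close>.
\<close>

definition hodge ::
    "'a set \<Rightarrow> (nat \<Rightarrow> 'a \<Rightarrow> real) \<Rightarrow> nat \<Rightarrow> 'a covector \<Rightarrow> 'a covector" where
  "hodge V e k \<omega> = (\<lambda>v. \<Sum>I | I \<subseteq> {1..7} \<and> card I = k.
      \<omega> (\<lambda>j. dual_frame V e (sorted_list_of_set I ! j)) *
      (-1) ^ card {(i, j). i \<in> I \<and> j \<in> {1..7} - I \<and> j < i} *
      coframe_wedge e (sorted_list_of_set ({1..7} - I)) v)"

definition form_wedge :: "nat \<Rightarrow> nat \<Rightarrow> 'a form \<Rightarrow> 'a form \<Rightarrow> 'a form" where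
  "form_wedge k l \<alpha> \<beta> = (\<lambda>p. wedge k l (\<alpha> p) (\<beta> p))"

definition form_hodge ::
    "'a::real_normed_vector set \<Rightarrow> ('a \<Rightarrow> nat \<Rightarrow> 'a \<Rightarrow> real) \<Rightarrow> nat \<Rightarrow> 'a form \<Rightarrow> 'a form" where
  "form_hodge M e k \<alpha> = (\<lambda>p. hodge (tangent_space M p) (e p) k (\<alpha> p))"

text \<open>
  \<open>\<phi>\<close> is a $\mathrm{G}_2T$-structure with Lee form \<open>\<theta>\<close>, and \<open>d\<phi>\<close> is its exterior derivative.
  (\<open>\<theta>\<close> is unique because wedging 1-forms with \<open>\<star>\<phi>\<close> is injective.)
\<close>

definition G2T_structure ::
    "'a::real_normed_vector set \<Rightarrow> 'a form \<Rightarrow> ('a \<Rightarrow> nat \<Rightarrow> 'a \<Rightarrow> real) \<Rightarrow> 'a form \<Rightarrow> 'a form \<Rightarrow> bool"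
  where
  "G2T_structure M \<phi> e d\<phi> \<theta> \<longleftrightarrow> G2_structure M \<phi> e \<and>
     has_exterior_derivative M 3 \<phi> d\<phi> \<and>
     differential_form M 1 \<theta> \<and>
     has_exterior_derivative M 4 (form_hodge M e 3 \<phi>) (form_wedge 1 4 \<theta> (form_hodge M e 3 \<phi>))"

definition torsion ::
    "'a::real_normed_vector set \<Rightarrow> 'a form \<Rightarrow> ('a \<Rightarrow> nat \<Rightarrow> 'a \<Rightarrow> real) \<Rightarrow> 'a form \<Rightarrow> 'a form \<Rightarrow> 'a form"
  where
  "torsion M \<phi> e d\<phi> \<theta> = (\<lambda>p v.
       1 / 6 * form_hodge M e 7 (form_wedge 4 3 d\<phi> \<phi>) p v * \<phi> p v
       - form_hodge M e 4 d\<phi> p v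
       + form_hodge M e 4 (form_wedge 1 3 \<theta> \<phi>) p v)"


section \<open>The Lie group $\mathrm{SU}(2)\times\mathrm{U}(1)^4$\<close>

definition conj_transpose :: "complex^2^2 \<Rightarrow> complex^2^2" where
  "conj_transpose A = (\<chi> i j. cnj (A $ j $ i))"

definition SU2 :: "(complex^2^2) set" where
  "SU2 = {A. conj_transpose A ** A = mat 1 \<and> det A = 1}"

definition U1_4 :: "(complex^4) set" where
  "U1_4 = {z. \<forall>i. cmod (z $ i) = 1}"

definition SU2_U1_4 :: "((complex^2^2) \<times> (complex^4)) set" where
  "SU2_U1_4 = SU2 \<times> U1_4"

definition group_mult ::
    "(complex^2^2) \<times> (complex^4) \<Rightarrow> (complex^2^2) \<times> (complex^4) \<Rightarrow> (complex^2^2) \<times> (complex^4)"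
  where
  "group_mult g h = (fst g ** fst h, \<chi> i. snd g $ i * snd h $ i)"

text \<open>
  Left-invariance of a form on the group; such forms are automatically smooth.
\<close>

definition left_invariant :: "nat \<Rightarrow> ((complex^2^2) \<times> (complex^4)) form \<Rightarrow> bool" where
  "left_invariant k \<alpha> \<longleftrightarrow>
     (\<forall>g\<in>SU2_U1_4. form_eq SU2_U1_4 k (pullback (group_mult g) \<alpha>) \<alpha>)"

end

theory Submission
  imports Defs
begin

text \<open>
  Let \<open>e 5, e 6, e 7\<close> be left-invariant on $\mathrm{SU}(2)$ with
  $de^5 = 2e^{67}$, $de^6 = 2e^{75}$, $de^7 = 2e^{56}$, and let \<open>e 1, \<dots>, e 4\<close> be the closed
  invariant forms of the circles.  In the coordinates \<open>e 4, \<dots>, e 7\<close> the 2-forms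
  $\omega_1 = e^{45} + e^{67}$, $\omega_2 = e^{46} - e^{57}$, $\omega_3 = -(e^{47} + e^{56})$
  are those of the hyperhermitian structure of the Hopf surface
  $\mathrm{SU}(2) \times \mathrm{U}(1)$: they satisfy $d\omega_i = \theta \wedge \omega_i$ with
  the closed form $\theta = -2e^4$.  For the standard form
  $\varphi = e^{123} + \sum_i e^i \wedge \omega_i$ this gives
  $d\varphi = \theta \wedge (\varphi - e^{123})$ and $d{\star}\varphi = \theta \wedge {\star}\varphi$,
  whence $d\varphi \wedge \varphi = 0$ and
  $T = \star(\theta \wedge e^{123}) = 2e^{567}$, which is closed and non-zero.
\<close>

section \<open>Sums over permutations\<close>

text \<open>The obstacle is that \<open>has_exterior_derivative\<close> asks for an extension of
  each form to an open subset of the ambient vector space and differentiates it there. The entries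
  of the inverse of A times dA are therefore written with conjugates and minors of A:
  \<open>lie_coframe p i v\<close> is then real-linear in \<open>v\<close> and in \<open>p\<close>
  on the whole ambient space. Its derivative in direction \<open>u\<close> is
  \<open>lie_coframe u i v\<close>, one extension serves at all points, and de^i(u, w) is the
  difference \<open>lie_coframe u i w - lie_coframe w i u\<close>. With (a, b) the first column of
  A, the structure equations on SU(2) become polynomial identities modulo |a|^2 + |b|^2 = 1. Wedge
  product, d and Hodge operator are sums over permutations or subsets. They are evaluated once and
  for all on monomials \<open>coframe_wedge e L\<close>: the wedge product concatenates index lists,
  d replaces one index by two, and the Hodge operator passes to the complementary list. For the
  concrete forms only the sorting of index lists remains.\<close>

abbreviation block_perm :: "nat \<Rightarrow> nat \<Rightarrow> (nat \<Rightarrow> nat) \<Rightarrow> nat \<Rightarrow> nat" where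
  "block_perm k l \<equiv> map_permutation {..<l} ((+) k)"

lemma bij_betw_add_lessThan: "bij_betw ((+) k) {..<l} {k..<k + l::nat}"
  by (rule bij_betwI[where g = "\<lambda>j. j - k"]) auto

lemma block_perm_permutes: "\<tau> permutes {..<l} \<Longrightarrow> block_perm k l \<tau> permutes {k..<k + l}"
  by (rule map_permutation_permutes[OF bij_betw_add_lessThan])

lemma block_perm_permutes_lessThan: "\<tau> permutes {..<l} \<Longrightarrow> block_perm k l \<tau> permutes {..<k + l}"
  by (rule permutes_subset[OF block_perm_permutes]) auto

lemma sign_block_perm: "\<tau> permutes {..<l} \<Longrightarrow> sign (block_perm k l \<tau>) = sign \<tau>"
  by (rule sign_map_permutation) auto

lemma block_perm_add: "j < l \<Longrightarrow> block_perm k l \<tau> (k + j) = k + \<tau> j"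
  by (rule map_permutation_apply) auto

lemma block_perm_less: "\<tau> permutes {..<l} \<Longrightarrow> j < k \<Longrightarrow> block_perm k l \<tau> j = j"
  using permutes_not_in[OF block_perm_permutes] by auto

lemma sum_block_perm:
  "(\<Sum>\<tau> | \<tau> permutes {k..<k + l}. f \<tau>) = (\<Sum>\<tau> | \<tau> permutes {..<l}. f (block_perm k l \<tau>))"
proof (rule sum.reindex_bij_witness
    [where i = "block_perm k l" and j = "map_permutation {k..<k + l} (\<lambda>j. j - k)"])
  have bij: "bij_betw (\<lambda>j. j - k) {k..<k + l} {..<l}"
    by (rule bij_betwI[where g = "(+) k"]) auto
  fix \<tau> assume \<tau>: "\<tau> \<in> {\<tau>. \<tau> permutes {k..<k + l}}"
  then show "map_permutation {k..<k + l} (\<lambda>j. j - k) \<tau> \<in> {\<tau>. \<tau> permutes {..<l}}"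
    using map_permutation_permutes[OF bij] by simp
  show eq: "block_perm k l (map_permutation {k..<k + l} (\<lambda>j. j - k) \<tau>) = \<tau>"
    by (rule map_permutation_compose_inv[OF bij]) (use \<tau> in auto)
  then show "f (block_perm k l (map_permutation {k..<k + l} (\<lambda>j. j - k) \<tau>)) = f \<tau>"
    by simp
next
  fix \<tau> assume \<tau>: "\<tau> \<in> {\<tau>. \<tau> permutes {..<l}}"
  then show "block_perm k l \<tau> \<in> {\<tau>. \<tau> permutes {k..<k + l}}"
    using block_perm_permutes by simp
  show "map_permutation {k..<k + l} (\<lambda>j. j - k) (block_perm k l \<tau>) = \<tau>"
    by (rule map_permutation_compose_inv[OF bij_betw_add_lessThan]) (use \<tau> in auto)
qed

text \<open>The cycle 0 -> i -> i-1 -> ... -> 1 -> 0. It moves argument \<open>i\<close> to the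
  front and keeps the order of the others, as in the formula for d; being a product of
  \<open>i\<close> adjacent transpositions, it has the sign (-1)^i of that formula.\<close>

primrec front_cycle :: "nat \<Rightarrow> nat \<Rightarrow> nat" where
  "front_cycle 0 = id"
| "front_cycle (Suc i) = Transposition.transpose i (Suc i) \<circ> front_cycle i"

lemma front_cycle_permutes: "front_cycle i permutes {..i}"
proof (induction i)
  case (Suc i)
  have "front_cycle i permutes {..Suc i}"
    by (rule permutes_subset[OF Suc]) auto
  then show ?case
    unfolding front_cycle.simps by (intro permutes_compose permutes_swap_id) auto
qed (auto intro: permutes_id)

lemma sign_front_cycle: "sign (front_cycle i) = (-1) ^ i"
proof (induction i)
  case (Suc i)
  have "permutation (front_cycle i)"
    using permutes_imp_permutation[OF _ front_cycle_permutes] by simp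
  then show ?case
    unfolding front_cycle.simps by (subst sign_compose) (simp_all add: permutation_swap_id sign_swap_id Suc)
qed auto

lemma front_cycle_0: "front_cycle i 0 = i"
  by (induction i) auto

lemma front_cycle_Suc: "front_cycle i (Suc j) = (if j < i then j else Suc j)"
  by (induction i arbitrary: j) (auto simp: Transposition.transpose_def)

lemma omit_conv_front_cycle: "omit i v j = v (front_cycle i (Suc j))"
  by (simp add: omit_def front_cycle_Suc)

text \<open>Decomposition into cosets of the stabiliser of 0, indexed by the image \<open>i\<close>
  of 0. With \<open>front_cycle i\<close> as representative the double sum has the shape produced by
  the exterior derivative: a direction \<open>v i\<close>, then an alternating sum over the
  remaining arguments.\<close>

lemma sum_permutes_Suc:
  fixes f :: "(nat \<Rightarrow> nat) \<Rightarrow> 'a::comm_monoid_add"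
  shows "(\<Sum>\<sigma> | \<sigma> permutes {..<Suc k}. f \<sigma>) =
    (\<Sum>i\<le>k. \<Sum>\<tau> | \<tau> permutes {..<k}. f (front_cycle i \<circ> block_perm 1 k \<tau>))"
proof -
  have ins: "{..<Suc k} = insert 0 {1..<1 + k}"
    by auto
  have "(\<Sum>\<sigma> | \<sigma> permutes {..<Suc k}. f \<sigma>) =
    (\<Sum>i\<in>insert 0 {1..<1 + k}. \<Sum>q | q permutes {1..<1 + k}. f (Transposition.transpose 0 i \<circ> q))"
    unfolding ins by (rule sum_over_permutations_insert) auto
  also have "\<dots> = (\<Sum>i\<le>k. \<Sum>q | q permutes {1..<1 + k}. f (front_cycle i \<circ> q))"
  proof (rule sum.cong)
    fix i assume "i \<in> {..k}"
    \<comment> \<open>The coset expansion just applied has the representatives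
      \<open>transpose 0 i\<close>. The quotient \<rho> of the two representatives fixes 0, so
      reindexing the inner sum absorbs it.\<close>
    define \<rho> where "\<rho> = Transposition.transpose 0 i \<circ> front_cycle i"
    have "front_cycle i permutes {..i}"
      by (rule front_cycle_permutes)
    then have "\<rho> permutes {..i}"
      unfolding \<rho>_def by (auto intro!: permutes_compose permutes_swap_id)
    moreover have "\<rho> 0 = 0"
      by (simp add: \<rho>_def front_cycle_0)
    ultimately have "\<rho> permutes {1..i}"
      using permutes_superset[of \<rho> "{..i}" "{1..i}"]
      by (metis DiffE One_nat_def atLeastAtMost_iff atMost_iff le_zero_eq not_less_eq_eq)
    then have \<rho>: "\<rho> permutes {1..<1 + k}"
      by (rule permutes_subset) (use \<open>i \<in> {..k}\<close> in auto)
    have fc: "front_cycle i = Transposition.transpose 0 i \<circ> \<rho>"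
      by (simp add: \<rho>_def o_assoc swap_id_idempotent)
    show "(\<Sum>q | q permutes {1..<1 + k}. f (Transposition.transpose 0 i \<circ> q)) =
        (\<Sum>q | q permutes {1..<1 + k}. f (front_cycle i \<circ> q))"
      unfolding fc o_assoc[symmetric]
      by (rule setum_permutations_compose_left[OF \<rho>, of "\<lambda>q. f (Transposition.transpose 0 i \<circ> q)"])
  qed auto
  also have "\<dots> = (\<Sum>i\<le>k. \<Sum>\<tau> | \<tau> permutes {..<k}. f (front_cycle i \<circ> block_perm 1 k \<tau>))"
    by (subst sum_block_perm) (rule refl)
  finally show ?thesis .
qed

lemma sign_front_cycle_block_perm:
  "\<tau> permutes {..<k} \<Longrightarrow> sign (front_cycle i \<circ> block_perm 1 k \<tau>) = (-1) ^ i * sign \<tau>"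
  using permutes_imp_permutation[OF _ front_cycle_permutes, of i]
    permutes_imp_permutation[OF _ block_perm_permutes[where l = k and k = 1]]
  by (simp add: sign_compose sign_front_cycle sign_block_perm)

lemma omit_permuted:
  "j < k \<Longrightarrow> omit i v (\<tau> j) = v ((front_cycle i \<circ> block_perm 1 k \<tau>) (Suc j))"
  using block_perm_add[where j = j and l = k and k = 1 and \<tau> = \<tau>] by (simp add: omit_conv_front_cycle)

lemma sum_sign_compose:
  fixes f :: "(nat \<Rightarrow> nat) \<Rightarrow> 'a::comm_ring_1"
  assumes "\<pi> permutes {..<n}"
  shows "(\<Sum>\<sigma> | \<sigma> permutes {..<n}. of_int (sign \<sigma>) * f (\<sigma> \<circ> \<pi>)) =
    of_int (sign \<pi>) * (\<Sum>\<sigma> | \<sigma> permutes {..<n}. of_int (sign \<sigma>) * f \<sigma>)"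
proof -
  have "(\<Sum>\<sigma> | \<sigma> permutes {..<n}. of_int (sign \<sigma>) * f \<sigma>) =
      (\<Sum>\<sigma> | \<sigma> permutes {..<n}. of_int (sign (\<sigma> \<circ> \<pi>)) * f (\<sigma> \<circ> \<pi>))"
    by (rule sum_permutations_compose_right[OF assms])
  also have "\<dots> = (\<Sum>\<sigma> | \<sigma> permutes {..<n}. of_int (sign \<pi>) * (of_int (sign \<sigma>) * f (\<sigma> \<circ> \<pi>)))"
    using permutes_imp_permutation[OF _ assms]
    by (intro sum.cong refl, subst sign_compose) (auto intro: permutes_imp_permutation)
  also have "\<dots> = of_int (sign \<pi>) * (\<Sum>\<sigma> | \<sigma> permutes {..<n}. of_int (sign \<sigma>) * f (\<sigma> \<circ> \<pi>))"
    by (simp add: sum_distrib_left mult.assoc)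
  finally have eq: "(\<Sum>\<sigma> | \<sigma> permutes {..<n}. of_int (sign \<sigma>) * f \<sigma>) = \<dots>" .
  have "of_int (sign \<pi>) * (\<Sum>\<sigma> | \<sigma> permutes {..<n}. of_int (sign \<sigma>) * f \<sigma>) =
      of_int (sign \<pi> * sign \<pi>) * (\<Sum>\<sigma> | \<sigma> permutes {..<n}. of_int (sign \<sigma>) * f (\<sigma> \<circ> \<pi>))"
    unfolding eq of_int_mult mult.assoc ..
  then show ?thesis
    by (simp only: sign_idempotent of_int_1 mult_1_left)
qed

section \<open>Wedge products of coframe elements\<close>

text \<open>Reordering the factors of each product turns a permutation of the indices into
  \<open>inv \<pi>\<close> acting on the right of the summation variable.\<close>

lemma coframe_wedge_permute_list:
  fixes e :: "nat \<Rightarrow> 'a \<Rightarrow> real"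
  assumes "\<pi> permutes {..<length L}"
  shows "coframe_wedge e (permute_list \<pi> L) v = of_int (sign \<pi>) * coframe_wedge e L v"
proof -
  let ?n = "length L"
  define f where "f \<sigma> = (\<Prod>j<?n. e (L ! j) (v (\<sigma> j)))" for \<sigma>
  have inv: "inv \<pi> permutes {..<?n}"
    using assms by (rule permutes_inv)
  have "(\<Prod>j<?n. e (permute_list \<pi> L ! j) (v (\<sigma> j))) = f (\<sigma> \<circ> inv \<pi>)" for \<sigma>
  proof -
    have "f (\<sigma> \<circ> inv \<pi>) = (\<Prod>j<?n. e (L ! \<pi> j) (v ((\<sigma> \<circ> inv \<pi>) (\<pi> j))))"
      unfolding f_def by (subst prod.permute[OF assms]) simp
    also have "\<dots> = (\<Prod>j<?n. e (permute_list \<pi> L ! j) (v (\<sigma> j)))"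
      by (intro prod.cong) (use assms in \<open>auto simp: permute_list_nth permutes_inverses\<close>)
    finally show ?thesis ..
  qed
  then have "coframe_wedge e (permute_list \<pi> L) v =
      (\<Sum>\<sigma> | \<sigma> permutes {..<?n}. of_int (sign \<sigma>) * f (\<sigma> \<circ> inv \<pi>))"
    by (simp add: coframe_wedge_def)
  also have "\<dots> = of_int (sign (inv \<pi>)) * (\<Sum>\<sigma> | \<sigma> permutes {..<?n}. of_int (sign \<sigma>) * f \<sigma>)"
    by (rule sum_sign_compose[OF inv])
  also have "sign (inv \<pi>) = sign \<pi>"
    using permutes_imp_permutation[OF _ assms] by (simp add: sign_inverse)
  finally show ?thesis
    by (simp add: coframe_wedge_def f_def)
qed

lemma coframe_wedge_permute_args:
  fixes e :: "nat \<Rightarrow> 'a \<Rightarrow> real"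
  assumes "\<pi> permutes {..<length L}"
  shows "coframe_wedge e L (v \<circ> \<pi>) = of_int (sign \<pi>) * coframe_wedge e L v"
proof -
  let ?S = "{\<sigma>. \<sigma> permutes {..<length L}}"
  have "of_int (sign \<pi>) * coframe_wedge e L v =
      of_int (sign \<pi>) * (\<Sum>\<sigma>\<in>?S. of_int (sign (\<pi> \<circ> \<sigma>)) * (\<Prod>j<length L. e (L ! j) (v ((\<pi> \<circ> \<sigma>) j))))"
    unfolding coframe_wedge_def by (subst setum_permutations_compose_left[OF assms]) (rule refl)
  also have "\<dots> = coframe_wedge e L (v \<circ> \<pi>)"
    unfolding coframe_wedge_def sum_distrib_left
  proof (intro sum.cong refl)
    fix \<sigma> assume \<sigma>: "\<sigma> \<in> ?S"
    then have "sign (\<pi> \<circ> \<sigma>) = sign \<pi> * sign \<sigma>"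
      using assms by (intro sign_compose) (auto intro: permutes_imp_permutation)
    then have "real_of_int (sign \<pi>) * real_of_int (sign (\<pi> \<circ> \<sigma>)) = real_of_int (sign \<sigma>)"
      by (metis of_int_mult sign_left_idempotent)
    then show "of_int (sign \<pi>) * (of_int (sign (\<pi> \<circ> \<sigma>)) * (\<Prod>j<length L. e (L ! j) (v ((\<pi> \<circ> \<sigma>) j)))) =
        of_int (sign \<sigma>) * (\<Prod>j<length L. e (L ! j) ((v \<circ> \<pi>) (\<sigma> j)))"
      by (simp add: mult.assoc[symmetric])
  qed
  finally show ?thesis ..
qed

text \<open>Transposing two equal entries fixes the list but reverses the sign.\<close>

lemma coframe_wedge_eq_0:
  assumes "\<not> distinct L"
  shows "coframe_wedge e L v = 0"
proof -
  obtain a b where ab: "a < length L" "b < length L" "a \<noteq> b" "L ! a = L ! b"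
    using assms by (auto simp: distinct_conv_nth)
  have perm: "Transposition.transpose a b permutes {..<length L}"
    using ab by (intro permutes_swap_id) auto
  have "permute_list (Transposition.transpose a b) L = L"
    using ab perm by (intro nth_equalityI) (auto simp: permute_list_nth Transposition.transpose_def)
  with coframe_wedge_permute_list[OF perm, of e v] show ?thesis
    using ab by (simp add: sign_swap_id)
qed

lemma coframe_wedge_swap:
  "coframe_wedge e (xs @ a # b # ys) v = - coframe_wedge e (xs @ b # a # ys) v"
proof -
  let ?t = "Transposition.transpose (length xs) (Suc (length xs))" and ?L = "xs @ b # a # ys"
  have perm: "?t permutes {..<length ?L}"
    by (intro permutes_swap_id) auto
  have "permute_list ?t ?L = xs @ a # b # ys"
    using perm
    by (intro nth_equalityI) (auto simp: permute_list_nth Transposition.transpose_def nth_append nth_Cons split: nat.splits)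
  with coframe_wedge_permute_list[OF perm, of e v] show ?thesis
    by (simp add: sign_swap_id)
qed

lemma coframe_wedge_cong:
  assumes "\<And>i. i < length L \<Longrightarrow> v i = w i"
  shows "coframe_wedge e L v = coframe_wedge e L w"
proof -
  have "(\<Prod>j<length L. e (L ! j) (v (\<sigma> j))) = (\<Prod>j<length L. e (L ! j) (w (\<sigma> j)))"
    if "\<sigma> permutes {..<length L}" for \<sigma>
    using that assms permutes_in_image[OF that] by (intro prod.cong) auto
  then show ?thesis
    unfolding coframe_wedge_def by (intro sum.cong) auto
qed

lemma alternating_coframe_wedge:
  assumes lin: "\<And>i. linear (e i)"
  shows "alternating_form V (length L) (coframe_wedge e L)"
  unfolding alternating_form_def
proof (intro conjI allI impI ballI)
  let ?n = "length L"
  show "coframe_wedge e L w = coframe_wedge e L v" if "\<forall>i<?n. v i \<in> V \<and> w i = v i" for v w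
    using that by (intro coframe_wedge_cong) auto
next
  let ?n = "length L"
  fix v i x y and a b :: real
  assume i: "i < ?n"
  have "(\<Prod>j<?n. e (L ! j) ((v(i := a *\<^sub>R x + b *\<^sub>R y)) (\<sigma> j))) =
      a * (\<Prod>j<?n. e (L ! j) ((v(i := x)) (\<sigma> j))) + b * (\<Prod>j<?n. e (L ! j) ((v(i := y)) (\<sigma> j)))"
    if \<sigma>: "\<sigma> permutes {..<?n}" for \<sigma>
  proof -
    \<comment> \<open>Exactly one factor of the product, the one at \<open>m\<close>, sees argument
      \<open>i\<close>; linearity in that argument is linearity of this factor.\<close>
    obtain m where m: "m < ?n" "\<sigma> m = i"
      using permutes_surj[OF \<sigma>] permutes_in_image[OF \<sigma>] i by (metis lessThan_iff surjD)
    have ne: "\<sigma> j \<noteq> i" if "j \<noteq> m" for j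
      using that m permutes_inj[OF \<sigma>] by (auto simp: inj_def)
    have rem: "(\<Prod>j<?n. e (L ! j) ((v(i := z)) (\<sigma> j))) =
        e (L ! m) z * (\<Prod>j\<in>{..<?n} - {m}. e (L ! j) (v (\<sigma> j)))" for z
      using m ne by (subst prod.remove[of _ m]) (auto intro!: prod.cong)
    show ?thesis
      unfolding rem linear_add[OF lin] linear_scale[OF lin] by (simp add: algebra_simps)
  qed
  then show "coframe_wedge e L (v(i := a *\<^sub>R x + b *\<^sub>R y)) =
      a * coframe_wedge e L (v(i := x)) + b * coframe_wedge e L (v(i := y))"
    unfolding coframe_wedge_def sum_distrib_left sum.distrib[symmetric]
    by (intro sum.cong) (auto simp: algebra_simps)
next
  fix v i j
  assume *: "i < length L" "j < length L" "(\<forall>l<length L. v l \<in> V) \<and> i \<noteq> j \<and> v i = v j"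
  have "v \<circ> Transposition.transpose i j = v"
    using * by (auto simp: fun_eq_iff Transposition.transpose_def)
  moreover have "Transposition.transpose i j permutes {..<length L}"
    using * by (intro permutes_swap_id) auto
  ultimately show "coframe_wedge e L v = 0"
    using coframe_wedge_permute_args[of "Transposition.transpose i j" L e v] * by (simp add: sign_swap_id)
qed

lemma prod_lessThan_add:
  fixes g :: "nat \<Rightarrow> 'a::comm_monoid_mult"
  shows "(\<Prod>j<k + l. g j) = (\<Prod>j<k. g j) * (\<Prod>j<l. g (k + j))"
  by (induction l) (simp_all add: mult.assoc)

text \<open>Expanding both factors gives a sum over triples \<sigma>, \<tau>1, \<tau>2. For fixed
  \<tau>1 and \<tau>2 the block permutation is absorbed into \<sigma> and the signs square to 1, so
  every pair contributes the same value. The k! l! pairs cancel the normalisation of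
  \<open>wedge\<close>.\<close>

lemma wedge_coframe_wedge:
  fixes e :: "nat \<Rightarrow> 'a \<Rightarrow> real"
  assumes k: "k = length I" and l: "l = length J"
  shows "wedge k l (coframe_wedge e I) (coframe_wedge e J) = coframe_wedge e (I @ J)"
proof
  fix v :: "nat \<Rightarrow> 'a"
  let ?P = "\<lambda>\<sigma>::nat \<Rightarrow> nat. \<Prod>j<k + l. e ((I @ J) ! j) (v (\<sigma> j))"
  let ?S = "{\<sigma>. \<sigma> permutes {..<k + l}}"
  have prod_split: "?P (\<sigma> \<circ> (\<tau>1 \<circ> block_perm k l \<tau>2)) =
      (\<Prod>j<k. e (I ! j) (v (\<sigma> (\<tau>1 j)))) * (\<Prod>j<l. e (J ! j) (v (\<sigma> (k + \<tau>2 j))))"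
    if \<tau>1: "\<tau>1 permutes {..<k}" and \<tau>2: "\<tau>2 permutes {..<l}" for \<sigma> \<tau>1 \<tau>2
  proof -
    have "?P (\<sigma> \<circ> (\<tau>1 \<circ> block_perm k l \<tau>2)) =
        (\<Prod>j<k. e ((I @ J) ! j) (v ((\<sigma> \<circ> (\<tau>1 \<circ> block_perm k l \<tau>2)) j))) *
        (\<Prod>j<l. e ((I @ J) ! (k + j)) (v ((\<sigma> \<circ> (\<tau>1 \<circ> block_perm k l \<tau>2)) (k + j))))"
      by (rule prod_lessThan_add)
    also have "(\<Prod>j<k. e ((I @ J) ! j) (v ((\<sigma> \<circ> (\<tau>1 \<circ> block_perm k l \<tau>2)) j))) =
        (\<Prod>j<k. e (I ! j) (v (\<sigma> (\<tau>1 j))))"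
      using k \<tau>2 by (intro prod.cong) (auto simp: nth_append block_perm_less)
    also have "(\<Prod>j<l. e ((I @ J) ! (k + j)) (v ((\<sigma> \<circ> (\<tau>1 \<circ> block_perm k l \<tau>2)) (k + j)))) =
        (\<Prod>j<l. e (J ! j) (v (\<sigma> (k + \<tau>2 j))))"
      using k permutes_not_in[OF \<tau>1] by (intro prod.cong) (auto simp: nth_append block_perm_add)
    finally show ?thesis .
  qed
  have alt: "(\<Sum>\<sigma>\<in>?S. of_int (sign \<sigma>) * ?P (\<sigma> \<circ> (\<tau>1 \<circ> block_perm k l \<tau>2))) =
      of_int (sign \<tau>1 * sign \<tau>2) * coframe_wedge e (I @ J) v"
    if \<tau>1: "\<tau>1 permutes {..<k}" and \<tau>2: "\<tau>2 permutes {..<l}" for \<tau>1 \<tau>2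
  proof -
    have "\<tau>1 permutes {..<k + l}"
      by (rule permutes_subset[OF \<tau>1]) auto
    then have "\<tau>1 \<circ> block_perm k l \<tau>2 permutes {..<k + l}"
      by (intro permutes_compose block_perm_permutes_lessThan \<tau>2)
    moreover have "sign (\<tau>1 \<circ> block_perm k l \<tau>2) = sign \<tau>1 * sign \<tau>2"
      using permutes_imp_permutation[OF _ \<tau>1] permutes_imp_permutation[OF _ block_perm_permutes[OF \<tau>2]]
      by (simp add: sign_compose sign_block_perm[OF \<tau>2])
    ultimately show ?thesis
      using sum_sign_compose[of "\<tau>1 \<circ> block_perm k l \<tau>2" "k + l" ?P] k l
      unfolding coframe_wedge_def by simp
  qed
  have "(\<Sum>\<sigma>\<in>?S. of_int (sign \<sigma>) * coframe_wedge e I (\<lambda>i. v (\<sigma> i)) * coframe_wedge e J (\<lambda>i. v (\<sigma> (k + i)))) =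
      (\<Sum>\<sigma>\<in>?S. \<Sum>\<tau>1 | \<tau>1 permutes {..<k}. \<Sum>\<tau>2 | \<tau>2 permutes {..<l}. of_int (sign \<tau>1 * sign \<tau>2) *
        (of_int (sign \<sigma>) * ?P (\<sigma> \<circ> (\<tau>1 \<circ> block_perm k l \<tau>2))))"
  proof (intro sum.cong refl)
    fix \<sigma>
    have "of_int (sign \<sigma>) * coframe_wedge e I (\<lambda>i. v (\<sigma> i)) * coframe_wedge e J (\<lambda>i. v (\<sigma> (k + i))) =
        of_int (sign \<sigma>) * (\<Sum>\<tau>1 | \<tau>1 permutes {..<k}. \<Sum>\<tau>2 | \<tau>2 permutes {..<l}.
          of_int (sign \<tau>1) * (\<Prod>j<k. e (I ! j) (v (\<sigma> (\<tau>1 j)))) *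
          (of_int (sign \<tau>2) * (\<Prod>j<l. e (J ! j) (v (\<sigma> (k + \<tau>2 j))))))"
      unfolding coframe_wedge_def k[symmetric] l[symmetric] sum_product[symmetric] by simp
    also have "\<dots> = (\<Sum>\<tau>1 | \<tau>1 permutes {..<k}. \<Sum>\<tau>2 | \<tau>2 permutes {..<l}. of_int (sign \<tau>1 * sign \<tau>2) *
        (of_int (sign \<sigma>) * ?P (\<sigma> \<circ> (\<tau>1 \<circ> block_perm k l \<tau>2))))"
      unfolding sum_distrib_left by (intro sum.cong refl, subst prod_split) simp_all
    finally show "of_int (sign \<sigma>) * coframe_wedge e I (\<lambda>i. v (\<sigma> i)) * coframe_wedge e J (\<lambda>i. v (\<sigma> (k + i))) =
      (\<Sum>\<tau>1 | \<tau>1 permutes {..<k}. \<Sum>\<tau>2 | \<tau>2 permutes {..<l}. of_int (sign \<tau>1 * sign \<tau>2) *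
        (of_int (sign \<sigma>) * ?P (\<sigma> \<circ> (\<tau>1 \<circ> block_perm k l \<tau>2))))" .
  qed
  also have "\<dots> = (\<Sum>\<tau>1 | \<tau>1 permutes {..<k}. \<Sum>\<tau>2 | \<tau>2 permutes {..<l}. \<Sum>\<sigma>\<in>?S. of_int (sign \<tau>1 * sign \<tau>2) *
        (of_int (sign \<sigma>) * ?P (\<sigma> \<circ> (\<tau>1 \<circ> block_perm k l \<tau>2))))"
    by (subst sum.swap, rule sum.cong[OF refl], rule sum.swap)
  also have "\<dots> = (\<Sum>\<tau>1 | \<tau>1 permutes {..<k}. \<Sum>\<tau>2 | \<tau>2 permutes {..<l}. coframe_wedge e (I @ J) v)"
  proof (intro sum.cong refl)
    fix \<tau>1 \<tau>2 assume "\<tau>1 \<in> {\<tau>. \<tau> permutes {..<k}}" "\<tau>2 \<in> {\<tau>. \<tau> permutes {..<l}}"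
    then have "(\<Sum>\<sigma>\<in>?S. of_int (sign \<tau>1 * sign \<tau>2) *
        (of_int (sign \<sigma>) * ?P (\<sigma> \<circ> (\<tau>1 \<circ> block_perm k l \<tau>2)))) =
        of_int ((sign \<tau>1 * sign \<tau>1) * (sign \<tau>2 * sign \<tau>2)) * coframe_wedge e (I @ J) v"
      unfolding sum_distrib_left[symmetric] by (subst alt) (simp_all only: mem_Collect_eq of_int_mult mult_ac)
    then show "(\<Sum>\<sigma>\<in>?S. of_int (sign \<tau>1 * sign \<tau>2) *
        (of_int (sign \<sigma>) * ?P (\<sigma> \<circ> (\<tau>1 \<circ> block_perm k l \<tau>2)))) = coframe_wedge e (I @ J) v"
      by (simp only: sign_idempotent of_int_1 mult_1_left)
  qed
  also have "\<dots> = fact k * fact l * coframe_wedge e (I @ J) v"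
    by (simp add: card_permutations[OF refl])
  finally show "wedge k l (coframe_wedge e I) (coframe_wedge e J) v = coframe_wedge e (I @ J) v"
    by (simp add: wedge_def)
qed

lemma wedge_add_left: "wedge k l (\<lambda>v. \<alpha> v + \<beta> v) \<gamma> = (\<lambda>v. wedge k l \<alpha> \<gamma> v + wedge k l \<beta> \<gamma> v)"
  by (simp add: wedge_def fun_eq_iff sum.distrib[symmetric] add_divide_distrib[symmetric] algebra_simps)

lemma wedge_add_right: "wedge k l \<gamma> (\<lambda>v. \<alpha> v + \<beta> v) = (\<lambda>v. wedge k l \<gamma> \<alpha> v + wedge k l \<gamma> \<beta> v)"
  by (simp add: wedge_def fun_eq_iff sum.distrib[symmetric] add_divide_distrib[symmetric] algebra_simps)

lemma wedge_scale_left: "wedge k l (\<lambda>v. c * \<alpha> v) \<gamma> = (\<lambda>v. c * wedge k l \<alpha> \<gamma> v)"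
  by (simp add: wedge_def fun_eq_iff sum_distrib_left algebra_simps)

lemma wedge_scale_right: "wedge k l \<gamma> (\<lambda>v. c * \<alpha> v) = (\<lambda>v. c * wedge k l \<gamma> \<alpha> v)"
  by (simp add: wedge_def fun_eq_iff sum_distrib_left algebra_simps)

lemma wedge_diff_left: "wedge k l (\<lambda>v. \<alpha> v - \<beta> v) \<gamma> = (\<lambda>v. wedge k l \<alpha> \<gamma> v - wedge k l \<beta> \<gamma> v)"
  using wedge_add_left[of k l \<alpha> "\<lambda>v. (-1) * \<beta> v" \<gamma>] wedge_scale_left[of k l "-1" \<beta> \<gamma>] by simp

lemma wedge_diff_right: "wedge k l \<gamma> (\<lambda>v. \<alpha> v - \<beta> v) = (\<lambda>v. wedge k l \<gamma> \<alpha> v - wedge k l \<gamma> \<beta> v)"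
  using wedge_add_right[of k l \<gamma> \<alpha> "\<lambda>v. (-1) * \<beta> v"] wedge_scale_right[of k l \<gamma> "-1" \<beta>] by simp

section \<open>Exterior derivatives\<close>

lemma alternating_form_cong:
  "alternating_form V k \<omega> \<Longrightarrow> \<forall>i<k. v i \<in> V \<and> w i = v i \<Longrightarrow> \<omega> w = \<omega> v"
  unfolding alternating_form_def by (drule conjunct1) blast

lemma alternating_form_linear:
  "alternating_form V k \<omega> \<Longrightarrow> i < k \<Longrightarrow> x \<in> V \<Longrightarrow> y \<in> V \<Longrightarrow> \<forall>j<k. v j \<in> V \<Longrightarrow>
    \<omega> (v(i := a *\<^sub>R x + b *\<^sub>R y)) = a * \<omega> (v(i := x)) + b * \<omega> (v(i := y))"
  unfolding alternating_form_def by (drule conjunct2, drule conjunct1) simp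

lemma alternating_form_repeat:
  "alternating_form V k \<omega> \<Longrightarrow> i < k \<Longrightarrow> j < k \<Longrightarrow> (\<forall>l<k. v l \<in> V) \<and> i \<noteq> j \<and> v i = v j \<Longrightarrow> \<omega> v = 0"
  unfolding alternating_form_def by (drule conjunct2, drule conjunct2) simp

lemma alternating_form_add:
  assumes "alternating_form V k \<alpha>" "alternating_form V k \<beta>"
  shows "alternating_form V k (\<lambda>v. \<alpha> v + \<beta> v)"
  unfolding alternating_form_def
proof (intro conjI allI impI ballI, goal_cases)
  case (1 v w)
  then show ?case
    by (simp only: alternating_form_cong[OF assms(1) 1] alternating_form_cong[OF assms(2) 1])
next
  case (2 v i x y a b)
  then show ?case
    by (simp only: alternating_form_linear[OF assms(1) 2] alternating_form_linear[OF assms(2) 2])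
      (simp add: algebra_simps)
next
  case (3 v i j)
  then show ?case
    by (simp only: alternating_form_repeat[OF assms(1) 3] alternating_form_repeat[OF assms(2) 3] add_0)
qed

lemma alternating_form_scale:
  assumes "alternating_form V k \<alpha>"
  shows "alternating_form V k (\<lambda>v. c * \<alpha> v)"
  unfolding alternating_form_def
proof (intro conjI allI impI ballI, goal_cases)
  case (1 v w)
  then show ?case
    by (simp only: alternating_form_cong[OF assms 1])
next
  case (2 v i x y a b)
  then show ?case
    by (simp only: alternating_form_linear[OF assms 2]) (simp add: algebra_simps)
next
  case (3 v i j)
  then show ?case
    by (simp only: alternating_form_repeat[OF assms 3] mult_zero_right)
qed

lemma alternating_form_minus: "alternating_form V k \<alpha> \<Longrightarrow> alternating_form V k (\<lambda>v. - \<alpha> v)"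
  using alternating_form_scale[of V k \<alpha> "-1"] by simp

lemma alternating_form_diff:
  "alternating_form V k \<alpha> \<Longrightarrow> alternating_form V k \<beta> \<Longrightarrow> alternating_form V k (\<lambda>v. \<alpha> v - \<beta> v)"
  using alternating_form_add[OF _ alternating_form_minus] by simp

text \<open>Neighbourhood and extension may vary with the point, so both are chosen at a fixed
  \<open>p\<close>; the extensions are added on the intersection of the neighbourhoods.\<close>

lemma has_exterior_derivative_add:
  assumes "has_exterior_derivative M k \<alpha> \<alpha>d" "has_exterior_derivative M k \<beta> \<beta>d"
  shows "has_exterior_derivative M k (\<lambda>p v. \<alpha> p v + \<beta> p v) (\<lambda>p v. \<alpha>d p v + \<beta>d p v)"
  unfolding has_exterior_derivative_def
proof
  fix p assume p: "p \<in> M"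
  obtain U \<alpha>' where U: "open U" "p \<in> U" "\<forall>q\<in>U. alternating_form UNIV k (\<alpha>' q)"
    "\<forall>q\<in>U. \<forall>v. (\<lambda>x. \<alpha>' x v) differentiable (at q)"
    "\<forall>q\<in>M \<inter> U. \<forall>v. (\<forall>i<k. v i \<in> tangent_space M q) \<longrightarrow> \<alpha>' q v = \<alpha> q v"
    "\<forall>v. (\<forall>i\<le>k. v i \<in> tangent_space M p) \<longrightarrow>
       \<alpha>d p v = (\<Sum>i\<le>k. (-1) ^ i * frechet_derivative (\<lambda>x. \<alpha>' x (omit i v)) (at p) (v i))"
    using bspec[OF assms(1)[unfolded has_exterior_derivative_def] p] by - (elim exE conjE, rule that)
  obtain W \<beta>' where W: "open W" "p \<in> W" "\<forall>q\<in>W. alternating_form UNIV k (\<beta>' q)"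
    "\<forall>q\<in>W. \<forall>v. (\<lambda>x. \<beta>' x v) differentiable (at q)"
    "\<forall>q\<in>M \<inter> W. \<forall>v. (\<forall>i<k. v i \<in> tangent_space M q) \<longrightarrow> \<beta>' q v = \<beta> q v"
    "\<forall>v. (\<forall>i\<le>k. v i \<in> tangent_space M p) \<longrightarrow>
       \<beta>d p v = (\<Sum>i\<le>k. (-1) ^ i * frechet_derivative (\<lambda>x. \<beta>' x (omit i v)) (at p) (v i))"
    using bspec[OF assms(2)[unfolded has_exterior_derivative_def] p] by - (elim exE conjE, rule that)
  have fd: "frechet_derivative (\<lambda>x. \<alpha>' x w + \<beta>' x w) (at p) =
      (\<lambda>h. frechet_derivative (\<lambda>x. \<alpha>' x w) (at p) h + frechet_derivative (\<lambda>x. \<beta>' x w) (at p) h)" for w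
    using U(2,4) W(2,4)
    by (intro frechet_derivative_at[symmetric] has_derivative_add) (auto simp: frechet_derivative_works[symmetric])
  show "\<exists>U \<gamma>. open U \<and> p \<in> U \<and> (\<forall>q\<in>U. alternating_form UNIV k (\<gamma> q)) \<and>
      (\<forall>q\<in>U. \<forall>v. (\<lambda>x. \<gamma> x v) differentiable (at q)) \<and>
      (\<forall>q\<in>M \<inter> U. \<forall>v. (\<forall>i<k. v i \<in> tangent_space M q) \<longrightarrow> \<gamma> q v = \<alpha> q v + \<beta> q v) \<and>
      (\<forall>v. (\<forall>i\<le>k. v i \<in> tangent_space M p) \<longrightarrow> \<alpha>d p v + \<beta>d p v =
        (\<Sum>i\<le>k. (-1) ^ i * frechet_derivative (\<lambda>x. \<gamma> x (omit i v)) (at p) (v i)))"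
  proof (intro exI[of _ "U \<inter> W"] exI[of _ "\<lambda>x v. \<alpha>' x v + \<beta>' x v"] conjI ballI allI impI)
    fix v assume "\<forall>i\<le>k. v i \<in> tangent_space M p"
    then show "\<alpha>d p v + \<beta>d p v = (\<Sum>i\<le>k. (-1) ^ i *
        frechet_derivative (\<lambda>x. \<alpha>' x (omit i v) + \<beta>' x (omit i v)) (at p) (v i))"
      using U(6) W(6) by (simp add: fd sum.distrib distrib_left)
  qed (use U(1-5) W(1-5) in \<open>simp_all add: open_Int alternating_form_add\<close>)
qed

lemma has_exterior_derivative_scale:
  assumes "has_exterior_derivative M k \<alpha> \<alpha>d"
  shows "has_exterior_derivative M k (\<lambda>p v. c * \<alpha> p v) (\<lambda>p v. c * \<alpha>d p v)"
  unfolding has_exterior_derivative_def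
proof
  fix p assume p: "p \<in> M"
  obtain U \<alpha>' where U: "open U" "p \<in> U" "\<forall>q\<in>U. alternating_form UNIV k (\<alpha>' q)"
    "\<forall>q\<in>U. \<forall>v. (\<lambda>x. \<alpha>' x v) differentiable (at q)"
    "\<forall>q\<in>M \<inter> U. \<forall>v. (\<forall>i<k. v i \<in> tangent_space M q) \<longrightarrow> \<alpha>' q v = \<alpha> q v"
    "\<forall>v. (\<forall>i\<le>k. v i \<in> tangent_space M p) \<longrightarrow>
       \<alpha>d p v = (\<Sum>i\<le>k. (-1) ^ i * frechet_derivative (\<lambda>x. \<alpha>' x (omit i v)) (at p) (v i))"
    using bspec[OF assms(1)[unfolded has_exterior_derivative_def] p] by - (elim exE conjE, rule that)
  have fd: "frechet_derivative (\<lambda>x. c * \<alpha>' x w) (at p) =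
      (\<lambda>h. c * frechet_derivative (\<lambda>x. \<alpha>' x w) (at p) h)" for w
    using U(2,4)
    by (intro frechet_derivative_at[symmetric] has_derivative_mult_right)
      (auto simp: frechet_derivative_works[symmetric])
  show "\<exists>U \<gamma>. open U \<and> p \<in> U \<and> (\<forall>q\<in>U. alternating_form UNIV k (\<gamma> q)) \<and>
      (\<forall>q\<in>U. \<forall>v. (\<lambda>x. \<gamma> x v) differentiable (at q)) \<and>
      (\<forall>q\<in>M \<inter> U. \<forall>v. (\<forall>i<k. v i \<in> tangent_space M q) \<longrightarrow> \<gamma> q v = c * \<alpha> q v) \<and>
      (\<forall>v. (\<forall>i\<le>k. v i \<in> tangent_space M p) \<longrightarrow> c * \<alpha>d p v =
        (\<Sum>i\<le>k. (-1) ^ i * frechet_derivative (\<lambda>x. \<gamma> x (omit i v)) (at p) (v i)))"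
  proof (intro exI[of _ U] exI[of _ "\<lambda>x v. c * \<alpha>' x v"] conjI ballI allI impI)
    fix v assume "\<forall>i\<le>k. v i \<in> tangent_space M p"
    then show "c * \<alpha>d p v = (\<Sum>i\<le>k. (-1) ^ i *
        frechet_derivative (\<lambda>x. c * \<alpha>' x (omit i v)) (at p) (v i))"
      using U(6) by (simp add: fd sum_distrib_left mult.left_commute)
  qed (use U(1-5) in \<open>simp_all add: alternating_form_scale\<close>)
qed

lemma has_exterior_derivative_minus:
  assumes "has_exterior_derivative M k \<alpha> \<alpha>d"
  shows "has_exterior_derivative M k (\<lambda>p v. - \<alpha> p v) (\<lambda>p v. - \<alpha>d p v)"
  using has_exterior_derivative_scale[OF assms, of "-1"] by simp

lemma has_exterior_derivative_diff:
  assumes "has_exterior_derivative M k \<alpha> \<alpha>d" "has_exterior_derivative M k \<beta> \<beta>d"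
  shows "has_exterior_derivative M k (\<lambda>p v. \<alpha> p v - \<beta> p v) (\<lambda>p v. \<alpha>d p v - \<beta>d p v)"
  using has_exterior_derivative_add[OF assms(1) has_exterior_derivative_minus[OF assms(2)]] by simp

lemma has_exterior_derivative_cong:
  assumes "has_exterior_derivative M k \<alpha> \<alpha>d"
    and "\<And>p v. p \<in> M \<Longrightarrow> \<beta> p v = \<alpha> p v" "\<And>p v. p \<in> M \<Longrightarrow> \<beta>d p v = \<alpha>d p v"
  shows "has_exterior_derivative M k \<beta> \<beta>d"
  using assms(1) unfolding has_exterior_derivative_def by (simp add: assms(2,3))

section \<open>The Leibniz rule for wedge products of 1-forms\<close>

text \<open>Exchanging the arguments 0 and \<open>m + 1\<close> reverses the sign of a permutation, so an
  alternating sum only sees the antisymmetric part of \<open>B\<close>.\<close>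

lemma alternating_sum_antisym:
  fixes B B' :: "'a \<Rightarrow> 'a \<Rightarrow> real"
  assumes m: "m < k"
    and B: "\<And>i j. i \<le> k \<Longrightarrow> j \<le> k \<Longrightarrow> B (v i) (v j) - B (v j) (v i) = B' (v i) (v j) - B' (v j) (v i)"
  shows "(\<Sum>\<sigma> | \<sigma> permutes {..<Suc k}. of_int (sign \<sigma>) *
        (B (v (\<sigma> 0)) (v (\<sigma> (Suc m))) * (\<Prod>j\<in>{..<k} - {m}. f j (v (\<sigma> (Suc j)))))) =
      (\<Sum>\<sigma> | \<sigma> permutes {..<Suc k}. of_int (sign \<sigma>) *
        (B' (v (\<sigma> 0)) (v (\<sigma> (Suc m))) * (\<Prod>j\<in>{..<k} - {m}. f j (v (\<sigma> (Suc j))))))"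
    (is "(\<Sum>\<sigma>\<in>?S. ?s \<sigma> * (_ \<sigma> * ?R \<sigma>)) = _")
proof -
  let ?t = "Transposition.transpose 0 (Suc m)"
  have t: "?t permutes {..<Suc k}"
    using m by (intro permutes_swap_id) auto
  have R: "?R (\<sigma> \<circ> ?t) = ?R \<sigma>" for \<sigma>
    by (intro prod.cong) (auto simp: Transposition.transpose_def)
  have flip: "(\<Sum>\<sigma>\<in>?S. ?s \<sigma> * (C (v (\<sigma> (Suc m))) (v (\<sigma> 0)) * ?R \<sigma>)) =
      - (\<Sum>\<sigma>\<in>?S. ?s \<sigma> * (C (v (\<sigma> 0)) (v (\<sigma> (Suc m))) * ?R \<sigma>))" for C :: "'a \<Rightarrow> 'a \<Rightarrow> real"
    using sum_sign_compose[OF t, of "\<lambda>\<sigma>. C (v (\<sigma> 0)) (v (\<sigma> (Suc m))) * ?R \<sigma>"] R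
    by (simp add: sign_swap_id)
  \<comment> \<open>By \<open>flip\<close>, twice the sum sees only C(u, w) - C(w, u), the quantity
    that the hypothesis controls.\<close>
  have double: "2 * (\<Sum>\<sigma>\<in>?S. ?s \<sigma> * (C (v (\<sigma> 0)) (v (\<sigma> (Suc m))) * ?R \<sigma>)) =
      (\<Sum>\<sigma>\<in>?S. ?s \<sigma> * ((C (v (\<sigma> 0)) (v (\<sigma> (Suc m))) - C (v (\<sigma> (Suc m))) (v (\<sigma> 0))) * ?R \<sigma>))"
    for C :: "'a \<Rightarrow> 'a \<Rightarrow> real"
    unfolding left_diff_distrib right_diff_distrib sum_subtractf flip by simp
  have "2 * (\<Sum>\<sigma>\<in>?S. ?s \<sigma> * (B (v (\<sigma> 0)) (v (\<sigma> (Suc m))) * ?R \<sigma>)) =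
      2 * (\<Sum>\<sigma>\<in>?S. ?s \<sigma> * (B' (v (\<sigma> 0)) (v (\<sigma> (Suc m))) * ?R \<sigma>))"
    unfolding double
  proof (rule sum.cong[OF refl])
    fix \<sigma> assume "\<sigma> \<in> ?S"
    then have \<sigma>: "\<sigma> permutes {..<Suc k}"
      by simp
    have "\<sigma> 0 \<le> k" "\<sigma> (Suc m) \<le> k"
      using permutes_in_image[OF \<sigma>, of 0] permutes_in_image[OF \<sigma>, of "Suc m"] m by auto
    then show "?s \<sigma> * ((B (v (\<sigma> 0)) (v (\<sigma> (Suc m))) - B (v (\<sigma> (Suc m))) (v (\<sigma> 0))) * ?R \<sigma>) =
        ?s \<sigma> * ((B' (v (\<sigma> 0)) (v (\<sigma> (Suc m))) - B' (v (\<sigma> (Suc m))) (v (\<sigma> 0))) * ?R \<sigma>)"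
      by (simp only: B)
  qed
  then show ?thesis
    by simp
qed

text \<open>Splits off positions 0 and \<open>m + 1\<close>, the two slots that
  \<open>alternating_sum_antisym\<close> exchanges.\<close>

lemma coframe_wedge_Cons_update:
  assumes m: "m < length L"
  shows "coframe_wedge e (x # L[m := y]) v =
    (\<Sum>\<sigma> | \<sigma> permutes {..<Suc (length L)}. of_int (sign \<sigma>) *
      (e x (v (\<sigma> 0)) * e y (v (\<sigma> (Suc m))) * (\<Prod>j\<in>{..<length L} - {m}. e (L ! j) (v (\<sigma> (Suc j))))))"
proof -
  have "(\<Prod>j<Suc (length L). e ((x # L[m := y]) ! j) (v (\<sigma> j))) =
      e x (v (\<sigma> 0)) * e y (v (\<sigma> (Suc m))) * (\<Prod>j\<in>{..<length L} - {m}. e (L ! j) (v (\<sigma> (Suc j))))" for \<sigma>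
    unfolding prod.lessThan_Suc_shift
    using m by (subst prod.remove[of "{..<length L}" m]) (auto intro!: prod.cong)
  then show ?thesis
    by (simp add: coframe_wedge_def)
qed

text \<open>Linearity in the base point makes \<open>e h i v\<close> the derivative of
  \<open>e p i v\<close> in direction \<open>h\<close>, so only the product rule is needed.\<close>

lemma coframe_wedge_has_derivative:
  assumes "\<And>i v. bounded_linear (\<lambda>p. e p i v)"
  shows "((\<lambda>p. coframe_wedge (e p) L v) has_derivative
    (\<lambda>h. \<Sum>\<sigma> | \<sigma> permutes {..<length L}. of_int (sign \<sigma>) *
      (\<Sum>m<length L. e h (L ! m) (v (\<sigma> m)) * (\<Prod>j\<in>{..<length L} - {m}. e p (L ! j) (v (\<sigma> j)))))) (at p)"
proof -
  have "((\<lambda>p. e p i v) has_derivative (\<lambda>h. e h i v)) (at p)" for i v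
    using assms by (rule bounded_linear_imp_has_derivative)
  then show ?thesis
    unfolding coframe_wedge_def
    by (intro has_derivative_sum has_derivative_mult_right has_derivative_prod)
qed

text \<open>The Leibniz rule for \<open>d\<close> of a wedge product of 1-forms, when the differential of
  \<open>e i\<close> is \<open>c i\<close> times \<open>e (x i) \<and> e (y i)\<close>.\<close>

definition coframe_wedge_d ::
    "(nat \<Rightarrow> real) \<Rightarrow> (nat \<Rightarrow> nat) \<Rightarrow> (nat \<Rightarrow> nat) \<Rightarrow> (nat \<Rightarrow> 'a \<Rightarrow> real) \<Rightarrow> nat list \<Rightarrow> 'a covector" where
  "coframe_wedge_d c x y e L = (\<lambda>v. \<Sum>m<length L.
     c (L ! m) * coframe_wedge e (x (L ! m) # L[m := y (L ! m)]) v)"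

text \<open>Linearity in \<open>p\<close> makes the form its own extension to the ambient space and
  turns the left side of hypothesis \<open>d\<close> into the differential of the 1-form with index
  \<open>i\<close>. The direction of differentiation occupies slot 0 of the resulting alternating
  sum, hence the new index given by \<open>x\<close> stands at the front; moving it there past
  \<open>m\<close> factors cancels the sign (-1)^m of the usual Leibniz rule.\<close>

lemma has_exterior_derivative_coframe_wedge:
  fixes e :: "'a::real_normed_vector \<Rightarrow> nat \<Rightarrow> 'a \<Rightarrow> real"
  assumes e1: "\<And>i v. bounded_linear (\<lambda>p. e p i v)" and e2: "\<And>p i. linear (e p i)"
    and d: "\<And>p i u w. p \<in> M \<Longrightarrow> u \<in> tangent_space M p \<Longrightarrow> w \<in> tangent_space M p \<Longrightarrow>
      e u i w - e w i u = c i * (e p (x i) u * e p (y i) w - e p (x i) w * e p (y i) u)"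
  shows "has_exterior_derivative M (length L) (\<lambda>p. coframe_wedge (e p) L)
    (\<lambda>p. coframe_wedge_d c x y (e p) L)"
  unfolding has_exterior_derivative_def
proof (intro ballI exI[of _ UNIV] exI[of _ "\<lambda>p. coframe_wedge (e p) L"] conjI allI impI)
  let ?k = "length L"
  fix p v assume p: "p \<in> M" and v: "\<forall>i\<le>?k. v i \<in> tangent_space M p"
  let ?R = "\<lambda>\<sigma> m. \<Prod>j\<in>{..<?k} - {m}. e p (L ! j) (v (\<sigma> (Suc j)))"
  have "(\<Sum>i\<le>?k. (-1) ^ i * frechet_derivative (\<lambda>x. coframe_wedge (e x) L (omit i v)) (at p) (v i)) =
      (\<Sum>i\<le>?k. \<Sum>\<tau> | \<tau> permutes {..<?k}. (-1) ^ i * (of_int (sign \<tau>) *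
        (\<Sum>m<?k. e (v i) (L ! m) (omit i v (\<tau> m)) *
          (\<Prod>j\<in>{..<?k} - {m}. e p (L ! j) (omit i v (\<tau> j))))))"
    unfolding frechet_derivative_at[OF coframe_wedge_has_derivative[OF e1], symmetric] sum_distrib_left ..
  \<comment> \<open>Direction index \<open>i\<close> and permutation \<tau> of the remaining
    arguments merge into one permutation \<sigma> of all \<open>Suc ?k\<close> arguments.\<close>
  also have "\<dots> = (\<Sum>i\<le>?k. \<Sum>\<tau> | \<tau> permutes {..<?k}. (\<lambda>\<sigma>. of_int (sign \<sigma>) *
        (\<Sum>m<?k. e (v (\<sigma> 0)) (L ! m) (v (\<sigma> (Suc m))) * ?R \<sigma> m)) (front_cycle i \<circ> block_perm 1 ?k \<tau>))"
  proof (intro sum.cong refl)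
    fix i \<tau> assume "\<tau> \<in> {\<tau>. \<tau> permutes {..<?k}}"
    then have \<tau>: "\<tau> permutes {..<?k}"
      by simp
    define \<sigma> where "\<sigma> = front_cycle i \<circ> block_perm 1 ?k \<tau>"
    have \<sigma>0: "\<sigma> 0 = i"
      using block_perm_less[OF \<tau>, of 0 1] by (simp add: \<sigma>_def front_cycle_0)
    have sgn: "sign \<sigma> = (-1) ^ i * sign \<tau>"
      unfolding \<sigma>_def by (rule sign_front_cycle_block_perm[OF \<tau>])
    have om: "omit i v (\<tau> j) = v (\<sigma> (Suc j))" if "j < ?k" for j
      unfolding \<sigma>_def by (rule omit_permuted[OF that])
    have "(\<Sum>m<?k. e (v i) (L ! m) (omit i v (\<tau> m)) * (\<Prod>j\<in>{..<?k} - {m}. e p (L ! j) (omit i v (\<tau> j)))) =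
        (\<Sum>m<?k. e (v (\<sigma> 0)) (L ! m) (v (\<sigma> (Suc m))) * ?R \<sigma> m)"
      by (intro sum.cong refl arg_cong2[of _ _ _ _ times] prod.cong) (auto simp: \<sigma>0 om)
    then show "(-1) ^ i * (of_int (sign \<tau>) *
        (\<Sum>m<?k. e (v i) (L ! m) (omit i v (\<tau> m)) *
          (\<Prod>j\<in>{..<?k} - {m}. e p (L ! j) (omit i v (\<tau> j))))) = (\<lambda>\<sigma>. of_int (sign \<sigma>) *
        (\<Sum>m<?k. e (v (\<sigma> 0)) (L ! m) (v (\<sigma> (Suc m))) * ?R \<sigma> m)) (front_cycle i \<circ> block_perm 1 ?k \<tau>)"
      unfolding \<sigma>_def[symmetric] sgn by simp
  qed
  also have "\<dots> = (\<Sum>\<sigma> | \<sigma> permutes {..<Suc ?k}. of_int (sign \<sigma>) *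
      (\<Sum>m<?k. e (v (\<sigma> 0)) (L ! m) (v (\<sigma> (Suc m))) * ?R \<sigma> m))"
    by (rule sum_permutes_Suc[symmetric])
  also have "\<dots> = (\<Sum>m<?k. \<Sum>\<sigma> | \<sigma> permutes {..<Suc ?k}. of_int (sign \<sigma>) *
      (e (v (\<sigma> 0)) (L ! m) (v (\<sigma> (Suc m))) * ?R \<sigma> m))"
    unfolding sum_distrib_left by (rule sum.swap)
  also have "\<dots> = (\<Sum>m<?k. c (L ! m) * coframe_wedge (e p) (x (L ! m) # L[m := y (L ! m)]) v)"
  proof (rule sum.cong[OF refl])
    fix m assume "m \<in> {..<?k}"
    then have m: "m < ?k"
      by simp
    let ?B = "\<lambda>u w. c (L ! m) * (e p (x (L ! m)) u * e p (y (L ! m)) w)"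
    \<comment> \<open>On the tangent vectors in question the derivative term and \<open>?B\<close>
      differ only by a symmetric part, which the alternating sum annihilates.\<close>
    have "(\<Sum>\<sigma> | \<sigma> permutes {..<Suc ?k}. of_int (sign \<sigma>) *
        (e (v (\<sigma> 0)) (L ! m) (v (\<sigma> (Suc m))) * ?R \<sigma> m)) =
        (\<Sum>\<sigma> | \<sigma> permutes {..<Suc ?k}. of_int (sign \<sigma>) * (?B (v (\<sigma> 0)) (v (\<sigma> (Suc m))) * ?R \<sigma> m))"
      by (rule alternating_sum_antisym[OF m, where B = "\<lambda>u w. e u (L ! m) w" and B' = ?B
          and f = "\<lambda>j. e p (L ! j)"])
        (use v d[OF p] in \<open>auto simp: algebra_simps\<close>)
    also have "\<dots> = c (L ! m) * coframe_wedge (e p) (x (L ! m) # L[m := y (L ! m)]) v"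
      unfolding coframe_wedge_Cons_update[OF m] sum_distrib_left
      by (intro sum.cong refl) simp
    finally show "(\<Sum>\<sigma> | \<sigma> permutes {..<Suc ?k}. of_int (sign \<sigma>) *
        (e (v (\<sigma> 0)) (L ! m) (v (\<sigma> (Suc m))) * ?R \<sigma> m)) =
      c (L ! m) * coframe_wedge (e p) (x (L ! m) # L[m := y (L ! m)]) v" .
  qed
  finally show "coframe_wedge_d c x y (e p) L v = (\<Sum>i\<le>?k. (-1) ^ i *
      frechet_derivative (\<lambda>x. coframe_wedge (e x) L (omit i v)) (at p) (v i))"
    by (simp add: coframe_wedge_d_def)
next
  fix q v
  show "(\<lambda>p. coframe_wedge (e p) L v) differentiable at q"
    unfolding differentiable_def by (rule exI) (rule coframe_wedge_has_derivative[OF e1])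
qed (auto intro!: alternating_coframe_wedge e2)

section \<open>The Hodge operator on wedge products of coframe elements\<close>

lemma dual_frame_eq:
  assumes "coframe7 V e" "i \<in> {1..7}" "j \<in> {1..7}"
  shows "e j (dual_frame V e i) = (if j = i then 1 else 0)"
proof -
  have "\<exists>!x. x \<in> V \<and> (\<forall>j\<in>{1..7}. e j x = (if j = i then 1 else 0))"
    using assms(1) unfolding coframe7_def by (elim conjE allE[of _ "\<lambda>j. if j = i then 1 else 0"])
  from theI'[OF this] show ?thesis
    using assms(3) unfolding dual_frame_def by blast
qed

text \<open>Both index lists increase strictly, so the product of Kronecker deltas survives only for
  equal index sets and the identity permutation.\<close>

lemma coframe_wedge_sorted_dual:
  assumes dual: "\<And>i j. i \<in> A \<Longrightarrow> j \<in> A \<Longrightarrow> e j (x i) = (if j = i then 1 else 0)"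
    and L: "sorted_wrt (<) L" "set L \<subseteq> A" and I: "I \<subseteq> A" "finite I" "card I = length L"
  shows "coframe_wedge e L (\<lambda>j. x (sorted_list_of_set I ! j)) = (if I = set L then 1 else 0)"
proof -
  let ?n = "length L" and ?I = "sorted_list_of_set I"
  have len: "length ?I = ?n"
    using I by simp
  have L': "distinct L" "sorted L"
    using L(1) strict_sorted_iff by blast+
  have prod: "(\<Prod>j<?n. e (L ! j) (x (?I ! \<sigma> j))) = (if I = set L \<and> \<sigma> = id then 1 else 0)"
    if \<sigma>: "\<sigma> permutes {..<?n}" for \<sigma>
  proof -
    have lt: "\<sigma> j < ?n" if "j < ?n" for j
      using permutes_in_image[OF \<sigma>, of j] that by simp
    have inI: "?I ! j \<in> I" if "j < ?n" for j
      using nth_mem[of j ?I] that len I by simp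
    have e: "e (L ! j) (x (?I ! \<sigma> j)) = (if L ! j = ?I ! \<sigma> j then 1 else 0)" if "j < ?n" for j
      using that lt[OF that] inI I L(2) by (intro dual) (auto dest!: nth_mem[of j L])
    have "(\<Prod>j<?n. e (L ! j) (x (?I ! \<sigma> j))) = (\<Prod>j<?n. if L ! j = ?I ! \<sigma> j then 1 else 0)"
      by (intro prod.cong refl e) simp
    also have "\<dots> = (if \<forall>j<?n. L ! j = ?I ! \<sigma> j then 1 else 0)"
      by (auto intro!: prod.neutral)
    also have "(\<forall>j<?n. L ! j = ?I ! \<sigma> j) \<longleftrightarrow> I = set L \<and> \<sigma> = id"
    proof
      assume eq: "\<forall>j<?n. L ! j = ?I ! \<sigma> j"
      then have "set L \<subseteq> I"
        using inI lt by (metis in_set_conv_nth subsetI)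
      then have IL: "I = set L"
        using I distinct_card[OF L'(1)] by (metis card_subset_eq)
      then have "?I = L"
        using L' by (simp add: sorted_list_of_set_sort_remdups distinct_remdups_id sorted_sort_id)
      with eq have "\<sigma> j = j" if "j < ?n" for j
        using that lt L'(1) nth_eq_iff_index_eq by metis
      moreover have "\<sigma> j = j" if "\<not> j < ?n" for j
        using permutes_not_in[OF \<sigma>] that by simp
      ultimately show "I = set L \<and> \<sigma> = id"
        using IL by (auto simp: fun_eq_iff)
    next
      assume "I = set L \<and> \<sigma> = id"
      then show "\<forall>j<?n. L ! j = ?I ! \<sigma> j"
        using L' by (simp add: sorted_list_of_set_sort_remdups distinct_remdups_id sorted_sort_id)
    qed
    finally show ?thesis .
  qed
  have "coframe_wedge e L (\<lambda>j. x (?I ! j)) =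
      (\<Sum>\<sigma> | \<sigma> permutes {..<?n}. if \<sigma> = id then (if I = set L then 1 else 0) else 0)"
    unfolding coframe_wedge_def by (intro sum.cong refl) (auto simp: prod)
  then show ?thesis
    by (simp add: sum.delta finite_permutations permutes_id)
qed

text \<open>Evaluation on the dual frame leaves the single summand \<open>I = set L\<close>. The
  sign is restated as the length of a filtered list of pairs, which rewriting can evaluate for
  concrete index lists.\<close>

lemma hodge_coframe_wedge:
  assumes e: "coframe7 V e" and L: "sorted_wrt (<) L" "sorted_wrt (<) L'"
    and c: "set L \<inter> set L' = {}" "set L \<union> set L' = {1..7}" and k: "k = length L"
  shows "hodge V e k (coframe_wedge e L) =
    (\<lambda>v. (-1) ^ length (filter (\<lambda>(i, j). j < i) (List.product L L')) * coframe_wedge e L' v)"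
proof
  fix v
  have d: "distinct L" "distinct L'" "sorted L'"
    using L strict_sorted_iff by blast+
  have compl: "{1..7} - set L = set L'"
    using c by auto
  let ?h = "\<lambda>I. (-1) ^ card {(i, j). i \<in> I \<and> j \<in> {1..7} - I \<and> j < i} *
      coframe_wedge e (sorted_list_of_set ({1..7} - I)) v"
  have "hodge V e k (coframe_wedge e L) v =
      (\<Sum>I | I \<subseteq> {1..7} \<and> card I = k. if I = set L then ?h (set L) else 0)"
    unfolding hodge_def
  proof (rule sum.cong[OF refl])
    fix I :: "nat set" assume "I \<in> {I. I \<subseteq> {1..7} \<and> card I = k}"
    then have I: "I \<subseteq> {1..7}" "finite I" "card I = length L"
      using k finite_subset[of I "{1..7}"] by auto
    have "coframe_wedge e L (\<lambda>j. dual_frame V e (sorted_list_of_set I ! j)) = (if I = set L then 1 else 0)"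
      using c by (intro coframe_wedge_sorted_dual[where A = "{1..7}", OF _ L(1) _ I] dual_frame_eq[OF e]) auto
    then show "coframe_wedge e L (\<lambda>j. dual_frame V e (sorted_list_of_set I ! j)) *
        (-1) ^ card {(i, j). i \<in> I \<and> j \<in> {1..7} - I \<and> j < i} *
        coframe_wedge e (sorted_list_of_set ({1..7} - I)) v = (if I = set L then ?h (set L) else 0)"
      by simp
  qed
  also have "\<dots> = ?h (set L)"
    using c k distinct_card[OF d(1)] by (subst sum.delta) auto
  also have "{(i, j). i \<in> set L \<and> j \<in> {1..7} - set L \<and> j < i} =
      set (filter (\<lambda>(i, j). j < i) (List.product L L'))"
    unfolding compl by auto
  also have "card \<dots> = length (filter (\<lambda>(i, j). j < i) (List.product L L'))"
    using d by (intro distinct_card distinct_filter distinct_product)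
  also have "sorted_list_of_set ({1..7} - set L) = L'"
    unfolding compl using d by (simp add: sorted_list_of_set_sort_remdups distinct_remdups_id sorted_sort_id)
  finally show "hodge V e k (coframe_wedge e L) v =
      (-1) ^ length (filter (\<lambda>(i, j). j < i) (List.product L L')) * coframe_wedge e L' v" .
qed

lemma hodge_add: "hodge V e k (\<lambda>v. \<alpha> v + \<beta> v) = (\<lambda>v. hodge V e k \<alpha> v + hodge V e k \<beta> v)"
  by (simp add: hodge_def fun_eq_iff sum.distrib[symmetric] algebra_simps)

lemma hodge_diff: "hodge V e k (\<lambda>v. \<alpha> v - \<beta> v) = (\<lambda>v. hodge V e k \<alpha> v - hodge V e k \<beta> v)"
  by (simp add: hodge_def fun_eq_iff sum_subtractf[symmetric] algebra_simps)

lemma hodge_scale: "hodge V e k (\<lambda>v. c * \<alpha> v) = (\<lambda>v. c * hodge V e k \<alpha> v)"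
  by (simp add: hodge_def fun_eq_iff sum_distrib_left algebra_simps)

section \<open>The group and its left-invariant coframe\<close>

type_synonym ambient = "(complex^2^2) \<times> (complex^4)"

text \<open>The real 4-dimensional space of quaternions inside the complex 2 by 2 matrices, with the
  first column as coordinates. SU(2) is its unit sphere, and the tangent vectors of SU(2) lie in it
  as well.\<close>

definition quat :: "complex \<Rightarrow> complex \<Rightarrow> complex^2^2" where
  "quat a b = vector [vector [a, - cnj b], vector [b, cnj a]]"

lemma quat_nth [simp]:
  "quat a b $ 1 $ 1 = a" "quat a b $ 1 $ 2 = - cnj b" "quat a b $ 2 $ 1 = b" "quat a b $ 2 $ 2 = cnj a"
  by (simp_all add: quat_def)

lemma matrix2_eq_iff:
  fixes A B :: "'a^2^2"
  shows "A = B \<longleftrightarrow> A $ 1 $ 1 = B $ 1 $ 1 \<and> A $ 1 $ 2 = B $ 1 $ 2 \<and> A $ 2 $ 1 = B $ 2 $ 1 \<and> A $ 2 $ 2 = B $ 2 $ 2"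
  by (auto simp: vec_eq_iff forall_2)

lemma SU2_iff:
  "A \<in> SU2 \<longleftrightarrow> A $ 2 $ 2 = cnj (A $ 1 $ 1) \<and> A $ 1 $ 2 = - cnj (A $ 2 $ 1) \<and>
    cnj (A $ 1 $ 1) * A $ 1 $ 1 + cnj (A $ 2 $ 1) * A $ 2 $ 1 = 1"
proof -
  have unit: "A \<in> SU2 \<longleftrightarrow> cnj (A $ 1 $ 1) * A $ 1 $ 1 + cnj (A $ 2 $ 1) * A $ 2 $ 1 = 1 \<and>
      cnj (A $ 1 $ 1) * A $ 1 $ 2 + cnj (A $ 2 $ 1) * A $ 2 $ 2 = 0 \<and>
      cnj (A $ 1 $ 2) * A $ 1 $ 1 + cnj (A $ 2 $ 2) * A $ 2 $ 1 = 0 \<and>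
      cnj (A $ 1 $ 2) * A $ 1 $ 2 + cnj (A $ 2 $ 2) * A $ 2 $ 2 = 1 \<and>
      A $ 1 $ 1 * A $ 2 $ 2 - A $ 1 $ 2 * A $ 2 $ 1 = 1"
    by (auto simp: SU2_def conj_transpose_def matrix2_eq_iff matrix_matrix_mult_def sum_2 mat_def det_2)
  show ?thesis
  proof
    assume "A \<in> SU2"
    then have h: "cnj (A $ 1 $ 1) * A $ 1 $ 1 + cnj (A $ 2 $ 1) * A $ 2 $ 1 = 1"
        "cnj (A $ 1 $ 1) * A $ 1 $ 2 + cnj (A $ 2 $ 1) * A $ 2 $ 2 = 0"
        "A $ 1 $ 1 * A $ 2 $ 2 - A $ 1 $ 2 * A $ 2 $ 1 = 1"
      unfolding unit by simp_all
    \<comment> \<open>Multiply each entry by |a|^2 + |b|^2 = 1, where (a, b) is the first column,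
      then use orthogonality of the columns and the determinant.\<close>
    have "A $ 2 $ 2 = cnj (A $ 1 $ 1)" "A $ 1 $ 2 = - cnj (A $ 2 $ 1)"
      using h by algebra+
    with h show "A $ 2 $ 2 = cnj (A $ 1 $ 1) \<and> A $ 1 $ 2 = - cnj (A $ 2 $ 1) \<and>
        cnj (A $ 1 $ 1) * A $ 1 $ 1 + cnj (A $ 2 $ 1) * A $ 2 $ 1 = 1"
      by simp
  qed (unfold unit, auto simp: algebra_simps)
qed

text \<open>Moduli are written as \<open>cnj z * z\<close>, which turns the conditions into
  polynomial equations accessible to \<open>algebra\<close>.\<close>

lemma SU2_U1_4_iff: "p \<in> SU2_U1_4 \<longleftrightarrow> fst p \<in> SU2 \<and> (\<forall>j. cnj (snd p $ j) * snd p $ j = 1)"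
proof -
  have "cmod z = 1 \<longleftrightarrow> (cmod z)\<^sup>2 = 1" for z
    using norm_ge_zero[of z] unfolding power2_eq_1_iff by linarith
  then have "cmod z = 1 \<longleftrightarrow> cnj z * z = 1" for z
    by (metis complex_norm_square mult.commute of_real_eq_1_iff)
  then show ?thesis
    by (auto simp: SU2_U1_4_def U1_4_def mem_Times_iff)
qed

text \<open>With \<open>det_form\<close>, the first column of the inverse of A times dA, where the
  inverse is replaced by the conjugate transpose here and by the adjugate in
  \<open>det_form\<close>. On SU(2) these matrices agree; off it the expressions remain
  real-bilinear in \<open>p\<close> and \<open>v\<close>.\<close>

definition angle_form :: "ambient \<Rightarrow> ambient \<Rightarrow> complex" where
  "angle_form p v = cnj (fst p $ 1 $ 1) * fst v $ 1 $ 1 + cnj (fst p $ 2 $ 1) * fst v $ 2 $ 1"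

definition det_form :: "ambient \<Rightarrow> ambient \<Rightarrow> complex" where
  "det_form p v = fst p $ 1 $ 1 * fst v $ 2 $ 1 - fst p $ 2 $ 1 * fst v $ 1 $ 1"

text \<open>At a point of the group, the first column of \<open>A\<^sup>-\<^sup>1 dA\<close> is
  \<open>(\<i> e\<^sup>5, e\<^sup>6 + \<i> e\<^sup>7)\<close>, and \<open>e\<^sup>1, \<dots>, e\<^sup>4\<close> are the angular forms of the circles.\<close>

definition lie_coframe :: "ambient \<Rightarrow> nat \<Rightarrow> ambient \<Rightarrow> real" where
  "lie_coframe p i v =
     (if i \<in> {1..4} then Im (cnj (snd p $ of_nat i) * snd v $ of_nat i)
      else if i = 5 then Im (angle_form p v)
      else if i = 6 then Re (det_form p v)
      else Im (det_form p v))"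

text \<open>For \<open>p\<close> in the group this is the left translate of a Lie algebra element:
  the first column is A applied to (i c5, c6 + i c7). The conditional undoes \<open>of_nat\<close>
  on the index type 4, in which the number 4 equals 0.\<close>

definition lie_frame :: "ambient \<Rightarrow> (nat \<Rightarrow> real) \<Rightarrow> ambient" where
  "lie_frame p c = (let a = fst p $ 1 $ 1; b = fst p $ 2 $ 1 in
     (quat (\<i> * c 5 * a - cnj b * Complex (c 6) (c 7)) (\<i> * c 5 * b + cnj a * Complex (c 6) (c 7)),
      \<chi> j. \<i> * c (if j = 1 then 1 else if j = 2 then 2 else if j = 3 then 3 else 4) * snd p $ j))"

lemma linear_lie_coframe: "linear (lie_coframe p i)"
  by (rule linearI) (auto simp: lie_coframe_def angle_form_def det_form_def algebra_simps)

lemma bounded_linear_lie_coframe: "bounded_linear (\<lambda>p. lie_coframe p i v)"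
proof -
  have "linear (\<lambda>p. lie_coframe p i v)"
    by (rule linearI) (auto simp: lie_coframe_def angle_form_def det_form_def algebra_simps)
  then show ?thesis
    by (simp add: linear_conv_bounded_linear)
qed

lemma linear_lie_frame:
  "lie_frame p (\<lambda>i. a * c i + b * d i) = a *\<^sub>R lie_frame p c + b *\<^sub>R lie_frame p d"
  by (auto simp: lie_frame_def Let_def prod_eq_iff matrix2_eq_iff vec_eq_iff complex_eq_iff algebra_simps)

lemma range_1_7: "i \<in> {1..7} \<longleftrightarrow> i \<in> {1..4} \<or> i = 5 \<or> i = 6 \<or> i = (7::nat)"
  by auto

lemma range_1_4: "i \<in> {1..4} \<longleftrightarrow> i = 1 \<or> i = 2 \<or> i = 3 \<or> i = (4::nat)"
  by auto

lemma forms_lie_frame: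
  assumes "p \<in> SU2_U1_4"
  shows "angle_form p (lie_frame p c) = \<i> * c 5" "det_form p (lie_frame p c) = Complex (c 6) (c 7)"
proof -
  have "cnj (fst p $ 1 $ 1) * fst p $ 1 $ 1 + cnj (fst p $ 2 $ 1) * fst p $ 2 $ 1 = 1"
    using assms by (simp add: SU2_U1_4_iff SU2_iff)
  then show "angle_form p (lie_frame p c) = \<i> * c 5" "det_form p (lie_frame p c) = Complex (c 6) (c 7)"
    unfolding angle_form_def det_form_def lie_frame_def Let_def fst_conv quat_nth by algebra+
qed

lemma lie_coframe_lie_frame:
  assumes p: "p \<in> SU2_U1_4" and i: "i \<in> {1..7}"
  shows "lie_coframe p i (lie_frame p c) = c i"
proof -
  have u: "cnj (snd p $ j) * (\<i> * x * snd p $ j) = \<i> * x" for j x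
    using p by (simp add: SU2_U1_4_iff mult.left_commute mult.commute)
  have "snd (lie_frame p c) $ j =
      \<i> * c (if j = 1 then 1 else if j = 2 then 2 else if j = 3 then 3 else 4) * snd p $ j" for j
    by (simp add: lie_frame_def Let_def)
  with i show ?thesis
    unfolding range_1_7 range_1_4 by (auto simp: lie_coframe_def forms_lie_frame[OF p] u)
qed

section \<open>Curves in the group and its tangent spaces\<close>

lemma has_vector_derivative_vec:
  fixes f :: "real \<Rightarrow> 'a::real_normed_vector^'n"
  assumes "\<And>i. ((\<lambda>t. f t $ i) has_vector_derivative f' $ i) (at x)"
  shows "(f has_vector_derivative f') (at x)"
  using assms unfolding has_vector_derivative_def has_derivative_def
  by (auto intro!: vec_tendstoI bounded_linear_scaleR_left)

lemma vec_nth_has_vector_derivative: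
  "(f has_vector_derivative f') F \<Longrightarrow> ((\<lambda>t. f t $ i) has_vector_derivative f' $ i) F"
  by (rule bounded_linear.has_vector_derivative[OF bounded_linear_vec_nth])

text \<open>The normalising factor is 1 at 0 and even in \<open>t\<close>, so its derivative there
  vanishes and only the direction \<open>w\<close> remains.\<close>

lemma unit_curve_has_vector_derivative:
  fixes z w :: complex
  shows "((\<lambda>t. (z + of_real t * w) / of_real (sqrt (1 + t\<^sup>2 * n))) has_vector_derivative w) (at 0)"
proof -
  have "((\<lambda>t. 1 / sqrt (1 + t\<^sup>2 * n)) has_real_derivative 0) (at 0)"
    by (auto intro!: derivative_eq_intros)
  moreover have "((\<lambda>t. z + of_real t * w) has_vector_derivative w) (at 0)"
    by (auto intro!: derivative_eq_intros)
  ultimately have "((\<lambda>t. (1 / sqrt (1 + t\<^sup>2 * n)) *\<^sub>R (z + of_real t * w)) has_vector_derivative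
      (1 / sqrt (1 + 0\<^sup>2 * n)) *\<^sub>R w + 0 *\<^sub>R (z + of_real 0 * w)) (at 0)"
    by (rule has_vector_derivative_scaleR)
  then show ?thesis
    by (simp add: scaleR_conv_of_real divide_inverse mult.commute)
qed

text \<open>Pythagoras: the direction is orthogonal to the unit vector (a, b), so the squared norm
  of the sum is exactly the number under the square root.\<close>

lemma unit_curve_unit:
  fixes a b X Y :: complex
  assumes "cnj a * a + cnj b * b = 1" "Re (cnj a * X + cnj b * Y) = 0"
  defines "s \<equiv> \<lambda>t. complex_of_real (sqrt (1 + t\<^sup>2 * ((cmod X)\<^sup>2 + (cmod Y)\<^sup>2)))"
  shows "cnj ((a + of_real t * X) / s t) * ((a + of_real t * X) / s t) +
    cnj ((b + of_real t * Y) / s t) * ((b + of_real t * Y) / s t) = 1"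
proof -
  define r where "r = 1 + t\<^sup>2 * ((cmod X)\<^sup>2 + (cmod Y)\<^sup>2)"
  have r: "r > 0"
    unfolding r_def by (intro add_pos_nonneg) auto
  have sq: "cnj (z / s t) * (z / s t) = of_real ((cmod z)\<^sup>2 / r)" for z
  proof -
    have "s t * s t = of_real r"
      unfolding s_def r_def[symmetric] using r by (simp flip: of_real_mult)
    moreover have "cnj (s t) = s t"
      by (simp add: s_def)
    moreover have "cnj z * z = of_real ((cmod z)\<^sup>2)"
      by (metis complex_norm_square mult.commute)
    ultimately show ?thesis
      by (simp only: complex_cnj_divide times_divide_times_eq of_real_divide)
  qed
  have "Re (cnj a * a + cnj b * b) = 1"
    using assms(1) by simp
  then have "(cmod (a + of_real t * X))\<^sup>2 + (cmod (b + of_real t * Y))\<^sup>2 = r + 2 * t * Re (cnj a * X + cnj b * Y)"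
    unfolding r_def cmod_power2 by (simp add: algebra_simps power2_eq_square)
  then have "(cmod (a + of_real t * X))\<^sup>2 / r + (cmod (b + of_real t * Y))\<^sup>2 / r = 1"
    unfolding assms(2) add_divide_distrib[symmetric] using r by simp
  then show ?thesis
    unfolding sq of_real_add[symmetric] by simp
qed

text \<open>Differentiate the constant squared norm; its derivative is twice this real part.\<close>

lemma Re_cnj_mult_deriv_0:
  assumes f: "(f has_vector_derivative f') (at 0)" and g: "(g has_vector_derivative g') (at 0)"
    and "\<And>t. cnj (f t) * f t + cnj (g t) * g t = 1"
  shows "Re (cnj (f 0) * f' + cnj (g 0) * g') = 0"
proof -
  have "((\<lambda>t. cnj (f t) * f t + cnj (g t) * g t) has_vector_derivative
      (cnj (f 0) * f' + cnj f' * f 0) + (cnj (g 0) * g' + cnj g' * g 0)) (at 0)"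
    by (intro has_vector_derivative_add has_vector_derivative_mult f g
      bounded_linear.has_vector_derivative[OF bounded_linear_cnj])
  then have "((\<lambda>t::real. 1::complex) has_vector_derivative
      (cnj (f 0) * f' + cnj f' * f 0) + (cnj (g 0) * g' + cnj g' * g 0)) (at 0)"
    by (simp add: assms(3))
  then have "(cnj (f 0) * f' + cnj f' * f 0) + (cnj (g 0) * g' + cnj g' * g 0) = 0"
    by (rule vector_derivative_unique_at) (rule has_vector_derivative_const)
  then have "Re ((cnj (f 0) * f' + cnj f' * f 0) + (cnj (g 0) * g' + cnj g' * g 0)) = 0"
    by simp
  then show ?thesis
    by (simp add: algebra_simps)
qed

lemma quat_has_vector_derivative:
  assumes f: "(f has_vector_derivative f') (at x)" and g: "(g has_vector_derivative g') (at x)"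
  shows "((\<lambda>t. quat (f t) (g t)) has_vector_derivative quat f' g') (at x)"
proof (rule has_vector_derivative_vec, rule has_vector_derivative_vec)
  fix i j :: 2
  note cnj_d = bounded_linear.has_vector_derivative[OF bounded_linear_cnj]
  have "\<forall>i j. ((\<lambda>t. quat (f t) (g t) $ i $ j) has_vector_derivative quat f' g' $ i $ j) (at x)"
    using f g cnj_d[OF f] has_vector_derivative_minus[OF cnj_d[OF g]] by (simp add: forall_2)
  then show "((\<lambda>t. quat (f t) (g t) $ i $ j) has_vector_derivative quat f' g' $ i $ j) (at x)"
    by blast
qed

text \<open>The straight line through \<open>p\<close> in the given direction, normalised to length 1 in
  \<open>SU(2)\<close>, regarded as the unit sphere, and in each circle, is a curve in the group.\<close>

lemma lie_frame_tangent:
  assumes p: "p \<in> SU2_U1_4"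
  shows "lie_frame p c \<in> tangent_space SU2_U1_4 p"
proof -
  define v where "v = lie_frame p c"
  define a where "a = fst p $ 1 $ 1"
  define b where "b = fst p $ 2 $ 1"
  define X where "X = fst v $ 1 $ 1"
  define Y where "Y = fst v $ 2 $ 1"
  have fst_v: "quat X Y = fst v"
    by (simp add: X_def Y_def v_def lie_frame_def Let_def)
  have fst_p: "quat a b = fst p"
    using p by (simp add: SU2_U1_4_iff SU2_iff matrix2_eq_iff a_def b_def)
  \<comment> \<open>A circle is the case of zero second component, so that
    \<open>unit_curve_unit\<close> covers both types of factor.\<close>
  have unit: "cnj a * a + cnj b * b = 1" "cnj (snd p $ j) * snd p $ j + cnj 0 * 0 = 1" for j
    using p by (simp_all add: SU2_U1_4_iff SU2_iff a_def b_def)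
  have "cnj a * X + cnj b * Y = \<i> * c 5"
    using forms_lie_frame(1)[OF p] by (simp add: angle_form_def v_def a_def b_def X_def Y_def)
  then have orth1: "Re (cnj a * X + cnj b * Y) = 0"
    by simp
  have "cnj (snd p $ j) * snd v $ j = \<i> * c (if j = 1 then 1 else if j = 2 then 2 else if j = 3 then 3 else 4)" for j
    using p by (simp add: SU2_U1_4_iff v_def lie_frame_def Let_def mult.left_commute mult.commute)
  then have orth2: "Re (cnj (snd p $ j) * snd v $ j + cnj 0 * 0) = 0" for j
    by simp
  define \<gamma> where "\<gamma> t = (quat ((a + of_real t * X) / of_real (sqrt (1 + t\<^sup>2 * ((cmod X)\<^sup>2 + (cmod Y)\<^sup>2))))
      ((b + of_real t * Y) / of_real (sqrt (1 + t\<^sup>2 * ((cmod X)\<^sup>2 + (cmod Y)\<^sup>2)))),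
    \<chi> j. (snd p $ j + of_real t * snd v $ j) / of_real (sqrt (1 + t\<^sup>2 * (cmod (snd v $ j))\<^sup>2)))" for t :: real
  have "\<gamma> t \<in> SU2_U1_4" for t
    using unit_curve_unit[OF unit(1) orth1, of t] unit_curve_unit[OF unit(2) orth2, of _ t]
    by (simp only: SU2_U1_4_iff SU2_iff \<gamma>_def fst_conv snd_conv quat_nth vec_lambda_beta simp_thms
      mult_zero_right mult_zero_left add_0_left add_0_right div_0 complex_cnj_zero norm_zero zero_power2)
  moreover have "\<gamma> 0 = p"
    by (simp add: \<gamma>_def prod_eq_iff vec_eq_iff fst_p)
  moreover have "(\<gamma> has_vector_derivative (quat X Y, snd v)) (at 0)"
    unfolding \<gamma>_def
    by (rule has_vector_derivative_Pair, rule quat_has_vector_derivative,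
      (rule unit_curve_has_vector_derivative)+, rule has_vector_derivative_vec, unfold vec_lambda_beta,
      rule unit_curve_has_vector_derivative)
  ultimately show ?thesis
    unfolding tangent_space_def v_def[symmetric] fst_v prod.collapse
    by (intro CollectI exI[of _ \<gamma>] conjI image_subsetI)
qed

text \<open>Differentiating the defining equations along a curve puts the matrix part of
  \<open>v\<close> into quaternionic form and makes the real parts of \<open>angle_form\<close> and
  of the circle components vanish. What is left are seven real numbers, the coframe values.\<close>

lemma tangent_eq_lie_frame:
  assumes p: "p \<in> SU2_U1_4" and v: "v \<in> tangent_space SU2_U1_4 p"
  shows "v = lie_frame p (\<lambda>i. lie_coframe p i v)"
proof -
  obtain \<gamma> where \<gamma>: "\<And>t. \<gamma> t \<in> SU2_U1_4" "\<gamma> 0 = p" "(\<gamma> has_vector_derivative v) (at 0)"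
    using v unfolding tangent_space_def by (auto simp: image_subset_iff)
  have d1: "((\<lambda>t. fst (\<gamma> t) $ i $ j) has_vector_derivative fst v $ i $ j) (at 0)" for i j
    by (intro vec_nth_has_vector_derivative bounded_linear.has_vector_derivative[OF bounded_linear_fst \<gamma>(3)])
  have d2: "((\<lambda>t. snd (\<gamma> t) $ j) has_vector_derivative snd v $ j) (at 0)" for j
    by (intro vec_nth_has_vector_derivative bounded_linear.has_vector_derivative[OF bounded_linear_snd \<gamma>(3)])
  note cnj_d = bounded_linear.has_vector_derivative[OF bounded_linear_cnj]
  have SU2: "fst (\<gamma> t) $ 2 $ 2 = cnj (fst (\<gamma> t) $ 1 $ 1)" "fst (\<gamma> t) $ 1 $ 2 = - cnj (fst (\<gamma> t) $ 2 $ 1)"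
    "cnj (fst (\<gamma> t) $ 1 $ 1) * fst (\<gamma> t) $ 1 $ 1 + cnj (fst (\<gamma> t) $ 2 $ 1) * fst (\<gamma> t) $ 2 $ 1 = 1"
    "cnj (snd (\<gamma> t) $ j) * snd (\<gamma> t) $ j = 1" for t j
    using \<gamma>(1)[of t] by (simp_all add: SU2_U1_4_iff SU2_iff)
  have v22: "fst v $ 2 $ 2 = cnj (fst v $ 1 $ 1)"
    using d1[of 2 2] cnj_d[OF d1[of 1 1]] unfolding SU2(1) by (rule vector_derivative_unique_at)
  have v12: "fst v $ 1 $ 2 = - cnj (fst v $ 2 $ 1)"
    using d1[of 1 2] has_vector_derivative_minus[OF cnj_d[OF d1[of 2 1]]] unfolding SU2(2)
    by (rule vector_derivative_unique_at)
  have "Re (angle_form p v) = 0"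
    using Re_cnj_mult_deriv_0[OF d1[of 1 1] d1[of 2 1] SU2(3)] by (simp add: angle_form_def \<gamma>(2))
  then have ang: "\<i> * Im (angle_form p v) = angle_form p v"
    by (simp add: complex_eq_iff)
  have "Re (cnj (snd p $ j) * snd v $ j) = 0" for j
    using Re_cnj_mult_deriv_0[OF d2[of j], of "\<lambda>_. 0" 0] SU2(4)[of _ j] \<gamma>(2) by simp
  then have circ: "\<i> * Im (cnj (snd p $ j) * snd v $ j) = cnj (snd p $ j) * snd v $ j" for j
    by (simp add: complex_eq_iff)
  have unit: "cnj (fst p $ 1 $ 1) * fst p $ 1 $ 1 + cnj (fst p $ 2 $ 1) * fst p $ 2 $ 1 = 1"
    "cnj (snd p $ j) * snd p $ j = 1" for j
    using p by (simp_all add: SU2_U1_4_iff SU2_iff)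
  define w where "w = lie_frame p (\<lambda>i. lie_coframe p i v)"
  have det: "Complex (lie_coframe p 6 v) (lie_coframe p 7 v) = det_form p v"
    by (simp add: lie_coframe_def)
  have ang': "\<i> * lie_coframe p 5 v = angle_form p v"
    by (simp add: lie_coframe_def ang)
  \<comment> \<open>Applying A to the first column of the inverse of A times \<open>fst v\<close>
    returns the first column of \<open>fst v\<close>.\<close>
  have w1: "fst w $ 1 $ 1 = fst v $ 1 $ 1" "fst w $ 2 $ 1 = fst v $ 2 $ 1"
    unfolding w_def lie_frame_def Let_def fst_conv quat_nth det ang'
    unfolding angle_form_def det_form_def using unit(1) by algebra+
  have w2: "fst w $ 2 $ 2 = cnj (fst w $ 1 $ 1)" "fst w $ 1 $ 2 = - cnj (fst w $ 2 $ 1)"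
    by (simp_all add: w_def lie_frame_def Let_def)
  have "snd w $ j = snd v $ j" for j
  proof -
    have "lie_coframe p (if j = 1 then 1 else if j = 2 then 2 else if j = 3 then 3 else 4) v =
        Im (cnj (snd p $ j) * snd v $ j)"
      using exhaust_4[of j] by (auto simp: lie_coframe_def)
    then have "snd w $ j = (\<i> * Im (cnj (snd p $ j) * snd v $ j)) * snd p $ j"
      by (simp add: w_def lie_frame_def Let_def)
    then have "snd w $ j = (cnj (snd p $ j) * snd v $ j) * snd p $ j"
      unfolding circ .
    then show ?thesis
      using unit(2)[of j] by algebra
  qed
  then have "w = v"
    by (auto simp: prod_eq_iff matrix2_eq_iff vec_eq_iff w1 w2 v22 v12)
  then show ?thesis
    by (simp add: w_def)
qed

lemma tangent_space_SU2_U1_4: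
  "p \<in> SU2_U1_4 \<Longrightarrow> tangent_space SU2_U1_4 p = range (lie_frame p)"
  using lie_frame_tangent tangent_eq_lie_frame by blast

lemma coframe7_lie_coframe:
  assumes p: "p \<in> SU2_U1_4"
  shows "coframe7 (tangent_space SU2_U1_4 p) (lie_coframe p)"
  unfolding coframe7_def
proof (intro conjI ballI allI)
  have "a *\<^sub>R lie_frame p c + b *\<^sub>R lie_frame p d \<in> range (lie_frame p)" for a b c d
    unfolding linear_lie_frame[symmetric] by simp
  \<comment> \<open>The three instances give zero, closure under sums and closure under scalar
    multiples.\<close>
  from this[of 0 _ 0] this[of 1 _ 1] this[of _ _ 0] show "subspace (tangent_space SU2_U1_4 p)"
    unfolding tangent_space_SU2_U1_4[OF p] by (auto simp: subspace_def)
next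
  fix c
  show "\<exists>!x. x \<in> tangent_space SU2_U1_4 p \<and> (\<forall>i\<in>{1..7}. lie_coframe p i x = c i)"
  proof (rule ex1I[of _ "lie_frame p c"])
    show "lie_frame p c \<in> tangent_space SU2_U1_4 p \<and> (\<forall>i\<in>{1..7}. lie_coframe p i (lie_frame p c) = c i)"
      using lie_frame_tangent[OF p] lie_coframe_lie_frame[OF p] by blast
  next
    fix x assume x: "x \<in> tangent_space SU2_U1_4 p \<and> (\<forall>i\<in>{1..7}. lie_coframe p i x = c i)"
    have "x = lie_frame p (\<lambda>i. lie_coframe p i x)"
      using x tangent_eq_lie_frame[OF p] by blast
    also have "\<dots> = lie_frame p c"
      using x unfolding lie_frame_def Let_def by simp
    finally show "x = lie_frame p c" .
  qed
qed (simp add: linear_add[OF linear_lie_coframe] linear_scale[OF linear_lie_coframe])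

section \<open>Structure equations and left invariance\<close>

definition lie_c :: "nat \<Rightarrow> real" where
  "lie_c i = (if i \<in> {1..4} then 0 else 2)"

definition lie_x :: "nat \<Rightarrow> nat" where
  "lie_x i = (if i = 5 then 6 else if i = 6 then 7 else 5)"

definition lie_y :: "nat \<Rightarrow> nat" where
  "lie_y i = (if i = 5 then 7 else if i = 6 then 5 else 6)"

text \<open>By linearity in the base point the left side is de^i(u, w). Left translation preserves
  the Hermitian product and the determinant of columns, so \<open>p\<close> drops out of
  \<open>ang\<close> and \<open>det\<close>. The imaginary part of \<open>ang\<close> and all of
  \<open>det\<close> are already antisymmetric in \<open>c\<close> and \<open>d\<close>; this is the
  origin of the factor 2. Indices outside 1..7 take the branch of index 7 throughout, so the
  equation holds for every \<open>i\<close>.\<close>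

lemma maurer_cartan_lie_coframe:
  assumes p: "p \<in> SU2_U1_4" and u: "u \<in> tangent_space SU2_U1_4 p" and w: "w \<in> tangent_space SU2_U1_4 p"
  shows "lie_coframe u i w - lie_coframe w i u =
    lie_c i * (lie_coframe p (lie_x i) u * lie_coframe p (lie_y i) w -
      lie_coframe p (lie_x i) w * lie_coframe p (lie_y i) u)"
proof -
  obtain c d where c: "u = lie_frame p c" and d: "w = lie_frame p d"
    using u w unfolding tangent_space_SU2_U1_4[OF p] by blast
  have unit: "cnj (fst p $ 1 $ 1) * fst p $ 1 $ 1 + cnj (fst p $ 2 $ 1) * fst p $ 2 $ 1 = 1"
    "cnj (snd p $ j) * snd p $ j = 1" for j
    using p by (simp_all add: SU2_U1_4_iff SU2_iff)
  note e = lie_coframe_lie_frame[OF p]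
  have circ: "Im (cnj (snd (lie_frame p c) $ j) * snd (lie_frame p d) $ j) = 0" for j c d
  proof -
    have "cnj (\<i> * of_real x * z) * (\<i> * of_real y * z) = of_real (x * y) * (cnj z * z)" for x y z
      by (simp add: algebra_simps)
    then show ?thesis
      by (simp add: lie_frame_def Let_def unit(2))
  qed
  have ang: "angle_form (lie_frame p c) (lie_frame p d) =
      of_real (c 5 * d 5) + cnj (Complex (c 6) (c 7)) * Complex (d 6) (d 7)" for c d
    using unit(1) i_squared
    unfolding angle_form_def lie_frame_def Let_def fst_conv quat_nth complex_cnj_diff complex_cnj_add
      complex_cnj_mult complex_cnj_cnj complex_cnj_i complex_cnj_complex_of_real of_real_mult
    by algebra
  have det: "det_form (lie_frame p c) (lie_frame p d) =
      \<i> * c 5 * Complex (d 6) (d 7) - \<i> * d 5 * Complex (c 6) (c 7)" for c d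
    using unit(1)
    unfolding det_form_def lie_frame_def Let_def fst_conv quat_nth by algebra
  consider "i \<in> {1..4}" | "i = 5" | "i = 6" | "i \<notin> {1..6}"
    by fastforce
  then show ?thesis
  proof cases
    case 1
    then show ?thesis
      by (simp only: lie_coframe_def lie_c_def c d circ if_True mult_zero_left diff_self)
  next
    case 4
    then show ?thesis
      by (auto simp: c d e lie_c_def lie_x_def lie_y_def lie_coframe_def[of "lie_frame p _"] det algebra_simps)
  qed (simp_all add: c d e lie_c_def lie_x_def lie_y_def lie_coframe_def[of "lie_frame p _"] ang det algebra_simps)
qed

text \<open>\<open>angle_form\<close> is the Hermitian product of the first columns and
  \<open>det_form\<close> their determinant; multiplication by an element of SU(2) preserves both.
  On the circles a unit factor cancels against its conjugate.\<close>

lemma lie_coframe_left_invariant: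
  assumes g: "g \<in> SU2_U1_4"
  shows "lie_coframe (group_mult g p) i (group_mult g v) = lie_coframe p i v"
proof -
  have G: "fst g $ 2 $ 2 = cnj (fst g $ 1 $ 1)" "fst g $ 1 $ 2 = - cnj (fst g $ 2 $ 1)"
    "cnj (fst g $ 1 $ 1) * fst g $ 1 $ 1 + cnj (fst g $ 2 $ 1) * fst g $ 2 $ 1 = 1"
    "cnj (snd g $ j) * snd g $ j = 1" for j
    using g by (simp_all add: SU2_U1_4_iff SU2_iff)
  have col: "fst (group_mult g q) $ 1 $ 1 = fst g $ 1 $ 1 * fst q $ 1 $ 1 - cnj (fst g $ 2 $ 1) * fst q $ 2 $ 1"
    "fst (group_mult g q) $ 2 $ 1 = fst g $ 2 $ 1 * fst q $ 1 $ 1 + cnj (fst g $ 1 $ 1) * fst q $ 2 $ 1" for q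
    by (simp_all add: group_mult_def matrix_matrix_mult_def sum_2 G)
  have "angle_form (group_mult g p) (group_mult g v) = angle_form p v"
    using G(3) unfolding angle_form_def col complex_cnj_diff complex_cnj_add complex_cnj_mult complex_cnj_cnj
    by algebra
  moreover have "det_form (group_mult g p) (group_mult g v) = det_form p v"
    using G(3) unfolding det_form_def col by algebra
  moreover have "cnj (snd (group_mult g p) $ j) * snd (group_mult g v) $ j = cnj (snd p $ j) * snd v $ j" for j
  proof -
    have "cnj (snd (group_mult g p) $ j) * snd (group_mult g v) $ j =
        (cnj (snd g $ j) * snd g $ j) * (cnj (snd p $ j) * snd v $ j)"
      by (simp add: group_mult_def)
    then show ?thesis
      by (simp only: G(4) mult_1_left)
  qed
  ultimately show ?thesis
    by (simp only: lie_coframe_def)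
qed

text \<open>Linearity makes \<open>group_mult g\<close> its own Frechet derivative in the
  pullback.\<close>

lemma linear_group_mult: "linear (group_mult g)"
  by (rule linearI) (auto simp: group_mult_def prod_eq_iff vec_eq_iff matrix_matrix_mult_def
      sum.distrib algebra_simps scaleR_sum_right)

section \<open>The strong $\mathrm{G}_2T$-structure\<close>

abbreviation lie_wedge :: "nat list \<Rightarrow> ambient form" where
  "lie_wedge L \<equiv> (\<lambda>p. coframe_wedge (lie_coframe p) L)"

definition g2_phi :: "ambient form" where
  "g2_phi p = g2_model (lie_coframe p)"

definition lee_form :: "ambient form" where
  "lee_form p = (\<lambda>v. - 2 * lie_wedge [4] p v)"

definition d_phi :: "ambient form" where
  "d_phi p = (\<lambda>v. 2 * lie_wedge [1,4,6,7] p v - 2 * lie_wedge [2,4,5,7] p v - 2 * lie_wedge [3,4,5,6] p v)"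

definition star_phi :: "ambient form" where
  "star_phi p = (\<lambda>v. lie_wedge [4,5,6,7] p v
     + (lie_wedge [2,3,6,7] p v + lie_wedge [2,3,4,5] p v)
     + (lie_wedge [1,3,5,7] p v - lie_wedge [1,3,4,6] p v)
     - (lie_wedge [1,2,5,6] p v + lie_wedge [1,2,4,7] p v))"

text \<open>Together these rules sort the index list of a wedge product of at most five 1-forms.\<close>

lemma coframe_wedge_sort:
  "b < a \<Longrightarrow> coframe_wedge e (a # b # L) v = - coframe_wedge e (b # a # L) v"
  "b < a \<Longrightarrow> coframe_wedge e (i # a # b # L) v = - coframe_wedge e (i # b # a # L) v"
  "b < a \<Longrightarrow> coframe_wedge e (i # j # a # b # L) v = - coframe_wedge e (i # j # b # a # L) v"
  "b < a \<Longrightarrow> coframe_wedge e (i # j # k # a # b # L) v = - coframe_wedge e (i # j # k # b # a # L) v"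
  using coframe_wedge_swap[of e "[]" a b L v] coframe_wedge_swap[of e "[i]" a b L v]
    coframe_wedge_swap[of e "[i, j]" a b L v] coframe_wedge_swap[of e "[i, j, k]" a b L v] by simp_all

lemma has_exterior_derivative_lie_wedge:
  assumes "k = length L"
  shows "has_exterior_derivative SU2_U1_4 k (lie_wedge L)
    (\<lambda>p. coframe_wedge_d lie_c lie_x lie_y (lie_coframe p) L)"
  unfolding assms
  by (rule has_exterior_derivative_coframe_wedge)
    (auto intro: bounded_linear_lie_coframe linear_lie_coframe maurer_cartan_lie_coframe)

lemma left_invariant_g2_phi: "left_invariant 3 g2_phi"
proof -
  have fd: "frechet_derivative (group_mult g) (at p) = group_mult g" for g p
    using linear_imp_has_derivative[OF linear_group_mult] by (rule frechet_derivative_at[symmetric])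
  have "lie_wedge L (group_mult g p) (\<lambda>i. group_mult g (v i)) = lie_wedge L p v"
    if "g \<in> SU2_U1_4" for L g p v
    by (simp add: coframe_wedge_def lie_coframe_left_invariant[OF that])
  then show ?thesis
    by (simp add: left_invariant_def form_eq_def pullback_def fd g2_phi_def g2_model_def)
qed

text \<open>Only the positive sign occurs in this structure: every index list used below has an even
  number of inversions with its complement.\<close>

lemma hodge_lie_wedge:
  assumes "p \<in> SU2_U1_4" "sorted_wrt (<) L" "sorted_wrt (<) L'"
    and "set L \<inter> set L' = {}" "set L \<union> set L' = {1..7}" "k = length L"
    and "even (length (filter (\<lambda>(i, j). j < i) (List.product L L')))"
  shows "hodge (tangent_space SU2_U1_4 p) (lie_coframe p) k (lie_wedge L p) = lie_wedge L' p"
  using hodge_coframe_wedge[OF coframe7_lie_coframe[OF assms(1)] assms(2-6)] assms(7) by simp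

lemma form_hodge_g2_phi:
  assumes "p \<in> SU2_U1_4"
  shows "form_hodge SU2_U1_4 lie_coframe 3 g2_phi p = star_phi p"
proof -
  let ?h = "\<lambda>L. hodge (tangent_space SU2_U1_4 p) (lie_coframe p) 3 (lie_wedge L p)"
  have "?h [1,2,3] = lie_wedge [4,5,6,7] p" "?h [1,4,5] = lie_wedge [2,3,6,7] p"
    "?h [1,6,7] = lie_wedge [2,3,4,5] p" "?h [2,4,6] = lie_wedge [1,3,5,7] p"
    "?h [2,5,7] = lie_wedge [1,3,4,6] p" "?h [3,4,7] = lie_wedge [1,2,5,6] p"
    "?h [3,5,6] = lie_wedge [1,2,4,7] p"
    by (rule hodge_lie_wedge[OF assms]; auto)+
  then show ?thesis
    unfolding form_hodge_def g2_phi_def g2_model_def star_phi_def hodge_add hodge_diff by simp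
qed

text \<open>Up to constants e^{67}, e^{57} and e^{56} are differentials, so e^{167}, e^{257} and
  e^{356} are closed, as is e^{123}. Only e^{145}, e^{246} and e^{347} contribute.\<close>

lemma has_exterior_derivative_g2_phi: "has_exterior_derivative SU2_U1_4 3 g2_phi d_phi"
proof (rule has_exterior_derivative_cong[where \<alpha> = g2_phi])
  show "has_exterior_derivative SU2_U1_4 3 g2_phi (\<lambda>p v. (let d = \<lambda>L. coframe_wedge_d lie_c lie_x lie_y (lie_coframe p) L v in
      d [1,2,3] + (d [1,4,5] + d [1,6,7]) + (d [2,4,6] - d [2,5,7]) - (d [3,4,7] + d [3,5,6])))"
    unfolding g2_phi_def g2_model_def Let_def
    by (intro has_exterior_derivative_add has_exterior_derivative_diff has_exterior_derivative_lie_wedge)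
      simp_all
qed (simp_all add: d_phi_def coframe_wedge_d_def lie_c_def lie_x_def lie_y_def Let_def
      coframe_wedge_sort coframe_wedge_eq_0)

lemma wedge_lee_form_star_phi:
  "form_wedge 1 4 lee_form star_phi p =
    (\<lambda>v. - 2 * (lie_wedge [2,3,4,6,7] p v + lie_wedge [1,3,4,5,7] p v - lie_wedge [1,2,4,5,6] p v))"
proof -
  have "form_wedge 1 4 lee_form star_phi p = (\<lambda>v. - 2 * (let w = \<lambda>L. lie_wedge (4 # L) p v in
      w [4,5,6,7] + (w [2,3,6,7] + w [2,3,4,5]) + (w [1,3,5,7] - w [1,3,4,6]) - (w [1,2,5,6] + w [1,2,4,7])))"
    unfolding form_wedge_def lee_form_def star_phi_def wedge_scale_left wedge_add_right wedge_diff_right Let_def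
    by (simp add: wedge_coframe_wedge)
  then show ?thesis
    by (simp add: Let_def coframe_wedge_sort coframe_wedge_eq_0)
qed

text \<open>The two sides arise from different monomials: d is non-zero on those with indices 2345,
  1346, 1247, while wedging with \<open>lee_form\<close> keeps 2367, 1357, 1256. They match because
  d exchanges e^5 for e^{67}, and likewise cyclically.\<close>

lemma has_exterior_derivative_star_phi:
  "has_exterior_derivative SU2_U1_4 4 (form_hodge SU2_U1_4 lie_coframe 3 g2_phi)
    (form_wedge 1 4 lee_form (form_hodge SU2_U1_4 lie_coframe 3 g2_phi))"
proof (rule has_exterior_derivative_cong[where \<alpha> = star_phi])
  show "has_exterior_derivative SU2_U1_4 4 star_phi (\<lambda>p v. (let d = \<lambda>L. coframe_wedge_d lie_c lie_x lie_y (lie_coframe p) L v in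
      d [4,5,6,7] + (d [2,3,6,7] + d [2,3,4,5]) + (d [1,3,5,7] - d [1,3,4,6]) - (d [1,2,5,6] + d [1,2,4,7])))"
    unfolding star_phi_def Let_def
    by (intro has_exterior_derivative_add has_exterior_derivative_diff has_exterior_derivative_lie_wedge)
      simp_all
next
  fix p v assume p: "p \<in> SU2_U1_4"
  have "form_wedge 1 4 lee_form (form_hodge SU2_U1_4 lie_coframe 3 g2_phi) p = form_wedge 1 4 lee_form star_phi p"
    by (simp add: form_wedge_def form_hodge_g2_phi[OF p])
  then show "form_wedge 1 4 lee_form (form_hodge SU2_U1_4 lie_coframe 3 g2_phi) p v =
      (let d = \<lambda>L. coframe_wedge_d lie_c lie_x lie_y (lie_coframe p) L v in
      d [4,5,6,7] + (d [2,3,6,7] + d [2,3,4,5]) + (d [1,3,5,7] - d [1,3,4,6]) - (d [1,2,5,6] + d [1,2,4,7]))"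
    by (simp add: wedge_lee_form_star_phi coframe_wedge_d_def lie_c_def lie_x_def lie_y_def Let_def
      coframe_wedge_sort coframe_wedge_eq_0 del: One_nat_def)
qed (simp add: form_hodge_g2_phi)

text \<open>The index triples complementary to the terms of \<open>d_phi\<close> are 235, 136 and
  127. None of them occurs in \<open>g2_phi\<close>, so every product repeats an index.\<close>

lemma wedge_d_phi_g2_phi: "form_wedge 4 3 d_phi g2_phi p = (\<lambda>v. 0)"
  unfolding form_wedge_def d_phi_def g2_phi_def g2_model_def wedge_scale_left
    wedge_diff_left wedge_add_right wedge_diff_right
  by (simp add: wedge_coframe_wedge coframe_wedge_eq_0)

text \<open>Split so that \<open>d_phi\<close> cancels against the second term of the torsion; the
  Hodge operator then has to be computed on e^{1234} only.\<close>

lemma wedge_lee_form_g2_phi: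
  "form_wedge 1 3 lee_form g2_phi p = (\<lambda>v. d_phi p v + 2 * lie_wedge [1,2,3,4] p v)"
proof -
  have "form_wedge 1 3 lee_form g2_phi p = (\<lambda>v. - 2 * (let w = \<lambda>L. lie_wedge (4 # L) p v in
      w [1,2,3] + (w [1,4,5] + w [1,6,7]) + (w [2,4,6] - w [2,5,7]) - (w [3,4,7] + w [3,5,6])))"
    unfolding form_wedge_def lee_form_def g2_phi_def g2_model_def wedge_scale_left wedge_add_right
      wedge_diff_right Let_def
    by (simp add: wedge_coframe_wedge)
  then show ?thesis
    by (simp add: d_phi_def Let_def coframe_wedge_sort coframe_wedge_eq_0 fun_eq_iff)
qed

lemma torsion_g2_phi:
  assumes "p \<in> SU2_U1_4"
  shows "torsion SU2_U1_4 g2_phi lie_coframe d_phi lee_form p v = 2 * lie_wedge [5,6,7] p v"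
proof -
  have star: "hodge (tangent_space SU2_U1_4 p) (lie_coframe p) 4 (lie_wedge [1,2,3,4] p) = lie_wedge [5,6,7] p"
    by (rule hodge_lie_wedge[OF assms]; auto)
  have "hodge V e 7 (\<lambda>v. 0) = (\<lambda>v. 0)" for V :: "ambient set" and e
    by (simp add: hodge_def)
  then show ?thesis
    unfolding torsion_def form_hodge_def wedge_d_phi_g2_phi wedge_lee_form_g2_phi hodge_add hodge_scale star
    by simp
qed

text \<open>The structure equations replace one of 5, 6, 7 by the other two, so every Leibniz term
  repeats an index.\<close>

lemma has_exterior_derivative_torsion:
  "has_exterior_derivative SU2_U1_4 3 (torsion SU2_U1_4 g2_phi lie_coframe d_phi lee_form) zero_form"
proof (rule has_exterior_derivative_cong)
  show "has_exterior_derivative SU2_U1_4 3 (\<lambda>p v. 2 * lie_wedge [5,6,7] p v)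
      (\<lambda>p v. 2 * coframe_wedge_d lie_c lie_x lie_y (lie_coframe p) [5,6,7] v)"
    by (intro has_exterior_derivative_scale has_exterior_derivative_lie_wedge) simp
qed (simp_all add: torsion_g2_phi zero_form_def coframe_wedge_d_def lie_x_def lie_y_def coframe_wedge_eq_0)

lemma has_exterior_derivative_lee_form: "has_exterior_derivative SU2_U1_4 1 lee_form zero_form"
proof (rule has_exterior_derivative_cong[where \<alpha> = lee_form])
  show "has_exterior_derivative SU2_U1_4 1 lee_form
      (\<lambda>p v. - 2 * coframe_wedge_d lie_c lie_x lie_y (lie_coframe p) [4] v)"
    unfolding lee_form_def
    by (intro has_exterior_derivative_scale has_exterior_derivative_lie_wedge) simp
qed (simp_all add: zero_form_def coframe_wedge_d_def lie_c_def)

lemma alternating_lie_wedge: "k = length L \<Longrightarrow> alternating_form V k (lie_wedge L p)"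
  using alternating_coframe_wedge[of "lie_coframe p"] by (simp add: linear_lie_coframe)

lemma G2T_structure_g2_phi: "G2T_structure SU2_U1_4 g2_phi lie_coframe d_phi lee_form"
  unfolding G2T_structure_def G2_structure_def differential_form_def
proof (intro conjI ballI)
  fix p
  show "alternating_form (tangent_space SU2_U1_4 p) 3 (g2_phi p)"
    unfolding g2_phi_def g2_model_def
    by (intro alternating_form_add alternating_form_diff alternating_lie_wedge) simp_all
  show "alternating_form (tangent_space SU2_U1_4 p) 1 (lee_form p)"
    unfolding lee_form_def by (intro alternating_form_scale alternating_lie_wedge) simp
  show "form_eq SU2_U1_4 3 g2_phi (\<lambda>p. g2_model (lie_coframe p))"
    by (simp add: form_eq_def g2_phi_def)
qed (rule coframe7_lie_coframe has_exterior_derivative_g2_phi has_exterior_derivative_star_phi, assumption?)+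

lemma torsion_nonzero:
  "\<not> form_eq SU2_U1_4 3 (torsion SU2_U1_4 g2_phi lie_coframe d_phi lee_form) zero_form"
proof
  assume zero: "form_eq SU2_U1_4 3 (torsion SU2_U1_4 g2_phi lie_coframe d_phi lee_form) zero_form"
  \<comment> \<open>The torsion is tested at the identity element, on the vectors dual to e^5, e^6
    and e^7.\<close>
  define p :: ambient where "p = (quat 1 0, \<chi> j. 1)"
  have p: "p \<in> SU2_U1_4"
    by (simp add: p_def SU2_U1_4_iff SU2_iff)
  define x where "x i = lie_frame p (\<lambda>j. if j = i then 1 else 0)" for i
  have "lie_wedge [5,6,7] p (\<lambda>j. x (sorted_list_of_set {5,6,7} ! j)) = (if {5,6,7} = set [5,6,7::nat] then 1 else 0)"
    by (rule coframe_wedge_sorted_dual[where A = "{1..7}"])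
      (auto simp: x_def lie_coframe_lie_frame[OF p])
  moreover have "torsion SU2_U1_4 g2_phi lie_coframe d_phi lee_form p (\<lambda>j. x (sorted_list_of_set {5,6,7} ! j)) = 0"
    using zero p lie_frame_tangent[OF p] by (simp add: form_eq_def zero_form_def x_def)
  ultimately show False
    by (simp add: torsion_g2_phi[OF p])
qed

theorem proposition6p1:
  "\<exists>\<phi> e d\<phi> \<theta>.
     left_invariant 3 \<phi> \<and>
     G2T_structure SU2_U1_4 \<phi> e d\<phi> \<theta> \<and>
     \<not> form_eq SU2_U1_4 3 (torsion SU2_U1_4 \<phi> e d\<phi> \<theta>) zero_form \<and>
     form_eq SU2_U1_4 7 (form_wedge 4 3 d\<phi> \<phi>) zero_form \<and>
     has_exterior_derivative SU2_U1_4 3 (torsion SU2_U1_4 \<phi> e d\<phi> \<theta>) zero_form \<and>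
     has_exterior_derivative SU2_U1_4 1 \<theta> zero_form"
proof (intro exI conjI)
  show "form_eq SU2_U1_4 7 (form_wedge 4 3 d_phi g2_phi) zero_form"
    by (simp add: form_eq_def wedge_d_phi_g2_phi zero_form_def)
qed (rule left_invariant_g2_phi G2T_structure_g2_phi torsion_nonzero
    has_exterior_derivative_torsion has_exterior_derivative_lee_form)+

end
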